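(* Let $\mathcal X,\mathcal Y,c,L,H$ satisfy the standing assumptions in the context, and assume there exists a gluing operator $\mathcal G:\mathcal X\times\mathcal X\times\mathcal Y\to\mathcal Y$ as defined in the context. Then there is a constant $C>0$ such that for all $\mu_0,\mu_1\in\mathscr P(\mathcal X)$ $$\left|\inf_{\gamma\in\mathscr P_{\mu_0}(\mathcal X\times\mathcal Y)}\mathcal J(\gamma)-\inf_{\gamma\in\mathscr P_{\mu_1}(\mathcal X\times\mathcal Y)}\mathcal J(\gamma)\right|\le C\,W_1(\mu_0,\mu_1).$$
   Context: Standing assumptions: $(\mathcal X,d_{\mathcal X})$ and $(\mathcal Y,d_{\mathcal Y})$ are Polish spaces; $c:\mathcal X\times\mathcal Y\to[0,+\infty]$, $L:\mathcal Y\to[0,+\infty]$, $H:\mathcal Y\times\mathcal Y\to[0,+\infty]$ are lower semi-continuous; $H$ is symmetric; $\{L\le\kappa\}$ is compact for every $\kappa>0$. Notation: $\mathscr P(\cdot)$ denotes Borel probability measures; $\pi_{\mathcal X},\pi_{\mathcal Y}$ are the projections, $\sharp$ is push-forward; for $\mu\in\mathscr P(\mathcal X)$, $\mathscr P_\mu(\mathcal X\times\mathcal Y)=\{\gamma\in\mathscr P(\mathcal X\times\mathcal Y):(\pi_{\mathcal X})_\sharp\gamma=\mu\}$. For such $\gamma$ with $\nu=(\pi_{\mathcal Y})_\sharp\gamma$, $\mathcal J(\gamma)=\int_{\mathcal X\times\mathcal Y}c\,d\gamma+\int_{\mathcal Y}L\,d\nu+\int_{\mathcal Y\times\mathcal Y}H\,d\nu\otimes\nu$.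 $W_1(\mu_0,\mu_1)=\min_{\pi\in\Pi(\mu_0,\mu_1)}\int_{\mathcal X\times\mathcal X}d_{\mathcal X}(x_0,x_1)\,d\pi$ is the 1-Wasserstein distance (values in $[0,+\infty]$), $\Pi(\mu_0,\mu_1)$ being the set of couplings. If both infima equal $+\infty$ their difference is understood as $0$. Gluing operator: $\mathcal G:\mathcal X\times\mathcal X\times\mathcal Y\to\mathcal Y$ such that $\mathcal G(x,x,y)=y$ for all $x\in\mathcal X,y\in\mathcal Y$, and there is a constant $C_0>0$ such that for all $x_0,x_1,\tilde x_0,\tilde x_1\in\mathcal X$ and $y,\tilde y\in\mathcal Y$: $c(x_1,\mathcal G(x_1,x_0,y))\le c(x_0,y)+C_0d_{\mathcal X}(x_1,x_0)$; $L(\mathcal G(x_1,x_0,y))\le L(y)+C_0d_{\mathcal X}(x_1,x_0)$; $H(\mathcal G(x_1,x_0,y),\mathcal G(\tilde x_1,\tilde x_0,\tilde y))\le H(y,\tilde y)+C_0\big(d_{\mathcal X}(x_1,x_0)+d_{\mathcal X}(\tilde x_1,\tilde x_0)\big)$. *)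

theory Defs
  imports "HOL-Probability.Probability"
begin

text \<open>
  Values in $[0,+\infty]$ are of type \<^typ>\<open>ennreal\<close>, on which every integral is the
  non-negative Lebesgue integral. A Polish space is a type of class \<^class>\<open>polish_space\<close>
  with its metric \<^const>\<open>dist\<close>.
\<close>

definition lower_semicontinuous :: "('a::topological_space \<Rightarrow> ennreal) \<Rightarrow> bool" where
  "lower_semicontinuous f \<longleftrightarrow> (\<forall>x. f x \<le> Liminf (at x) f)"

definition borel_probs :: "('a::topological_space) measure set" where
  "borel_probs = {\<mu>. prob_space \<mu> \<and> sets \<mu> = sets borel}"

definition probs_with_fst_marginal ::
  "('a::topological_space) measure \<Rightarrow> ('a \<times> 'b::topological_space) measure set" where
  "probs_with_fst_marginal \<mu> = {\<gamma> \<in> borel_probs. distr \<gamma> borel fst = \<mu>}"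

definition couplings ::
  "('a::topological_space) measure \<Rightarrow> 'a measure \<Rightarrow> ('a \<times> 'a) measure set" where
  "couplings \<mu>\<^sub>0 \<mu>\<^sub>1 =
     {\<pi> \<in> borel_probs. distr \<pi> borel fst = \<mu>\<^sub>0 \<and> distr \<pi> borel snd = \<mu>\<^sub>1}"

text \<open>
  The minimum over couplings is written as an infimum; on a Polish space the infimum is attained.
\<close>

definition wasserstein1 :: "('a::metric_space) measure \<Rightarrow> 'a measure \<Rightarrow> ennreal" where
  "wasserstein1 \<mu>\<^sub>0 \<mu>\<^sub>1 =
     (INF \<pi>\<in>couplings \<mu>\<^sub>0 \<mu>\<^sub>1. \<integral>\<^sup>+(x\<^sub>0, x\<^sub>1). ennreal (dist x\<^sub>0 x\<^sub>1) \<partial>\<pi>)"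

definition total_cost ::
  "('a::topological_space \<times> 'b::topological_space \<Rightarrow> ennreal) \<Rightarrow> ('b \<Rightarrow> ennreal) \<Rightarrow>
   ('b \<times> 'b \<Rightarrow> ennreal) \<Rightarrow> ('a \<times> 'b) measure \<Rightarrow> ennreal" where
  "total_cost c L H \<gamma> =
     (let \<nu> = distr \<gamma> borel snd
      in (\<integral>\<^sup>+z. c z \<partial>\<gamma>) + (\<integral>\<^sup>+y. L y \<partial>\<nu>) + (\<integral>\<^sup>+w. H w \<partial>(\<nu> \<Otimes>\<^sub>M \<nu>)))"

definition gluing_operator ::
  "('a::metric_space \<times> 'b \<Rightarrow> ennreal) \<Rightarrow> ('b \<Rightarrow> ennreal) \<Rightarrow> ('b \<times> 'b \<Rightarrow> ennreal) \<Rightarrow>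
   ('a \<Rightarrow> 'a \<Rightarrow> 'b \<Rightarrow> 'b) \<Rightarrow> bool" where
  "gluing_operator c L H G \<longleftrightarrow>
     (\<forall>x y. G x x y = y) \<and>
     (\<exists>C\<^sub>0>0. \<forall>x\<^sub>0 x\<^sub>1 x\<^sub>0' x\<^sub>1' y y'.
        c (x\<^sub>1, G x\<^sub>1 x\<^sub>0 y) \<le> c (x\<^sub>0, y) + ennreal (C\<^sub>0 * dist x\<^sub>1 x\<^sub>0) \<and>
        L (G x\<^sub>1 x\<^sub>0 y) \<le> L y + ennreal (C\<^sub>0 * dist x\<^sub>1 x\<^sub>0) \<and>
        H (G x\<^sub>1 x\<^sub>0 y, G x\<^sub>1' x\<^sub>0' y')
          \<le> H (y, y') + ennreal (C\<^sub>0 * (dist x\<^sub>1 x\<^sub>0 + dist x\<^sub>1' x\<^sub>0')))"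

text \<open>
  The absolute difference in $[0,+\infty]$ with the convention that $|\infty - \infty| = 0$;
  on \<^typ>\<open>ereal\<close> itself the difference of two infinities is infinite.
\<close>

definition abs_difference :: "ennreal \<Rightarrow> ennreal \<Rightarrow> ereal" where
  "abs_difference a b = (if a = \<infinity> \<and> b = \<infinity> then 0 else \<bar>enn2ereal a - enn2ereal b\<bar>)"

end

theory Submission
  imports Defs
begin

text \<open>
  Let \<open>\<gamma>\<close> be a plan with first marginal \<open>\<mu>\<^sub>0\<close> and let \<open>\<pi>\<close> couple \<open>\<mu>\<^sub>0\<close> to \<open>\<mu>\<^sub>1\<close>. The natural competitor
  for \<open>\<mu>\<^sub>1\<close> glues \<open>\<pi>\<close> and \<open>\<gamma>\<close> along \<open>x\<^sub>0\<close> to a law of triples \<open>(x\<^sub>1, x\<^sub>0, y)\<close> and pushes it forward by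
  \<open>(x\<^sub>1, G x\<^sub>1 x\<^sub>0 y)\<close>. Each of the terms with \<open>c\<close> and \<open>L\<close> grows by at most
  \<open>C\<^sub>0 \<integral> dist x\<^sub>1 x\<^sub>0\<close> and the term with \<open>H\<close> by at most twice that, hence the constant \<open>4 * C\<^sub>0\<close>; exchanging
  the two marginals gives the other inequality. The obstacle is that \<open>G\<close> is an arbitrary function,
  possibly non-measurable, so that this push-forward makes no sense. The gluing inequality for \<open>H\<close>
  involves two triples at once, so a measurable selection made one triple at a time does not help.

  The way out is to apply \<open>G\<close> to countably many triples only. The space of \<open>x\<^sub>1\<close> is cut into
  countably many small cells, and in each cell \<open>n\<close> triples are drawn independently from the conditional law.
  The expected discrete cost, with the terms \<open>H (y\<^sub>i, y\<^sub>j)\<close>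
  counted for \<open>i \<noteq> j\<close> only, does not exceed the cost of the law of triples, so some choice of
  sample points does at least as well (\<open>sampling_from_mixture\<close>, \<open>discrete_approximation\<close>). Applying
  \<open>G\<close> to these points yields discrete competitors whose first marginals are close to \<open>\<mu>\<^sub>1\<close>
  (\<open>discrete_competitor\<close>).

  The discrete competitors are tight, since \<open>L\<close> has compact sublevel sets, and a subsequence
  converges in law. Realising this convergence by almost surely converging random variables
  (\<open>skorohod_subsequence\<close>) reduces the passage to the limit to Fatou's lemma and lower
  semicontinuity (\<open>limit_of_discrete_competitors\<close>). The missing diagonal terms are harmless: for the
  truncation \<open>min H m\<close> they contribute at most \<open>m / n\<close>, and the truncation is removed at the end by
  monotone convergence.

  Since only infima are compared, arbitrarily small errors may be spent: the gluing is done up to cells of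
  diameter \<open>\<epsilon>\<close>, by an explicit density with respect to \<open>\<pi> \<Otimes>\<^sub>M \<gamma>\<close> (\<open>approximate_gluing\<close>).
\<close>

section \<open>Coding bit sequences by real numbers\<close>

text \<open>
  Bit sequences are coded as points of the middle-thirds Cantor set. The gaps of that set separate
  sequences that differ in an early bit, so convergence of codes on the real line forces
  every bit to stabilise.
\<close>

definition cantor_code :: "(nat \<Rightarrow> bool) \<Rightarrow> real" where
  "cantor_code b = (\<Sum>k. (if b k then 2 else 0) / 3 ^ Suc k)"

text \<open>
  Reading a digit and rescaling by \<open>3\<close> is a Borel operation on the whole line, so that decoding
  is a Borel map defined for all real numbers.
\<close>

primrec cantor_digit :: "nat \<Rightarrow> real \<Rightarrow> bool" where
  "cantor_digit 0 t \<longleftrightarrow> 1/2 \<le> t"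
| "cantor_digit (Suc k) t \<longleftrightarrow> cantor_digit k (3 * t - (if 1/2 \<le> t then 2 else 0))"

lemma cantor_code_geometric: "(\<lambda>k. 2 / 3 ^ Suc k :: real) sums 1"
  using sums_mult[OF geometric_sums[of "1/3::real"], of "2/3"]
  by (simp add: power_divide)

lemma cantor_code_summable: "summable (\<lambda>k. (if b k then 2 else 0) / 3 ^ Suc k :: real)"
  by (rule summable_comparison_test'[OF sums_summable[OF cantor_code_geometric], of 0]) auto

lemma cantor_code_bounds: "0 \<le> cantor_code b" "cantor_code b \<le> 1"
proof -
  show "0 \<le> cantor_code b"
    unfolding cantor_code_def by (rule suminf_nonneg[OF cantor_code_summable]) auto
  have "cantor_code b \<le> (\<Sum>k. 2 / 3 ^ Suc k)"
    unfolding cantor_code_def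
    by (rule suminf_le[OF _ cantor_code_summable sums_summable[OF cantor_code_geometric]]) auto
  then show "cantor_code b \<le> 1"
    using sums_unique[OF cantor_code_geometric] by simp
qed

lemma cantor_code_shift:
  "3 * cantor_code b = (if b 0 then 2 else 0) + cantor_code (\<lambda>k. b (Suc k))"
proof -
  have "cantor_code b = (if b 0 then 2 else 0) / 3 + (\<Sum>k. (if b (Suc k) then 2 else 0) / 3 ^ Suc (Suc k))"
    unfolding cantor_code_def using suminf_split_head[OF cantor_code_summable[of b]] by simp
  also have "(\<Sum>k. (if b (Suc k) then 2 else 0) / 3 ^ Suc (Suc k) :: real)
      = (\<Sum>k. (1/3) * ((if b (Suc k) then 2 else 0) / 3 ^ Suc k))"
    by (intro suminf_cong) simp
  also have "\<dots> = (1/3) * cantor_code (\<lambda>k. b (Suc k))"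
    unfolding cantor_code_def by (rule suminf_mult[OF cantor_code_summable])
  finally show ?thesis by simp
qed

lemma cantor_code_first_digit: "1/2 \<le> cantor_code b \<longleftrightarrow> b 0"
  using cantor_code_shift[of b] cantor_code_bounds[of "\<lambda>k. b (Suc k)"] by (auto split: if_splits)

lemma cantor_digit_code: "cantor_digit k (cantor_code b) \<longleftrightarrow> b k"
proof (induction k arbitrary: b)
  case 0
  show ?case unfolding cantor_digit.simps by (rule cantor_code_first_digit)
next
  case (Suc k)
  have "3 * cantor_code b - (if 1/2 \<le> cantor_code b then 2 else 0) = cantor_code (\<lambda>k. b (Suc k))"
    unfolding cantor_code_first_digit using cantor_code_shift[of b] by simp
  then show ?case using Suc by simp
qed

text \<open>
  Codes lie in \<open>[0, 1/3]\<close> or in \<open>[2/3, 1]\<close> according to their first bit, and a limit of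
  codes cannot be approached from both intervals.
\<close>

lemma cantor_first_digit_stabilises:
  assumes "(\<lambda>n. cantor_code (b n)) \<longlonglongrightarrow> t"
  shows "\<forall>\<^sub>F n in sequentially. b n 0 \<longleftrightarrow> 1/2 \<le> t"
proof (cases "1/2 \<le> t")
  case True
  then have "\<forall>\<^sub>F n in sequentially. 1/3 < cantor_code (b n)"
    using order_tendstoD(1)[OF assms, of "1/3"] by simp
  then show ?thesis
  proof eventually_elim
    case (elim n)
    then show ?case using True cantor_code_shift[of "b n"] cantor_code_bounds[of "\<lambda>k. b n (Suc k)"]
      by (auto split: if_splits)
  qed
next
  case False
  then have "\<forall>\<^sub>F n in sequentially. cantor_code (b n) < 1/2"
    using order_tendstoD(2)[OF assms, of "1/2"] by simp
  then show ?thesis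
    by eventually_elim (use False cantor_code_first_digit in \<open>simp flip: cantor_code_first_digit\<close>)
qed

lemma cantor_digits_stabilise:
  assumes "(\<lambda>n. cantor_code (b n)) \<longlonglongrightarrow> t"
  shows "\<forall>\<^sub>F n in sequentially. b n k \<longleftrightarrow> cantor_digit k t"
  using assms
proof (induction k arbitrary: b t)
  case 0
  then show ?case using cantor_first_digit_stabilises by simp
next
  case (Suc k)
  let ?s = "if 1/2 \<le> t then 2 else 0 :: real"
  have "(\<lambda>n. 3 * cantor_code (b n) - ?s) \<longlonglongrightarrow> 3 * t - ?s"
    by (intro tendsto_intros Suc.prems)
  moreover have "\<forall>\<^sub>F n in sequentially. 3 * cantor_code (b n) - ?s = cantor_code (\<lambda>k. b n (Suc k))"
    using cantor_first_digit_stabilises[OF Suc.prems]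
    by eventually_elim (simp add: cantor_code_shift)
  ultimately have "(\<lambda>n. cantor_code (\<lambda>k. b n (Suc k))) \<longlonglongrightarrow> 3 * t - ?s"
    by (rule Lim_transform_eventually)
  from Suc.IH[OF this] show ?case by simp
qed

lemma measurable_cantor_digit [measurable]: "Measurable.pred borel (cantor_digit k)"
proof (induction k)
  case (Suc k)
  then show ?case unfolding cantor_digit.simps
    by (rule measurable_compose[rotated]) measurable
qed simp

lemma measurable_cantor_code [measurable]:
  assumes [measurable]: "\<And>k. Measurable.pred M (\<lambda>x. b x k)"
  shows "(\<lambda>x. cantor_code (b x)) \<in> borel_measurable M"
  unfolding cantor_code_def by measurable

section \<open>Almost sure representation of tight sequences of laws\<close>

lemma countable_dense_sequence:
  obtains q :: "nat \<Rightarrow> 'a::{metric_space, second_countable_topology}"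
  where "\<And>x e. 0 < e \<Longrightarrow> \<exists>i. dist x (q i) < e"
proof -
  obtain D :: "'a set" where D: "countable D" "\<And>X. open X \<Longrightarrow> X \<noteq> {} \<Longrightarrow> \<exists>d\<in>D. d \<in> X"
    by (rule countable_dense_setE) auto
  have "D \<noteq> {}" using D(2)[of UNIV] by auto
  then have range: "range (from_nat_into D) = D"
    by (rule range_from_nat_into[OF _ D(1)])
  have "\<exists>i. dist x (from_nat_into D i) < e" if "0 < e" for x e
  proof -
    have "\<exists>d\<in>D. d \<in> ball x e"
      using that by (intro D(2)) auto
    then show ?thesis
      using range by (metis mem_ball rangeE)
  qed
  then show thesis by (rule that)
qed

text \<open>
  The default value \<open>z\<close> off the Cauchy set makes the pointwise limit exist everywhere.
\<close>

lemma borel_measurable_lim_if_Cauchy: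
  fixes f :: "nat \<Rightarrow> 'a \<Rightarrow> 'b::{complete_space, second_countable_topology}"
  assumes [measurable]: "\<And>n. f n \<in> borel_measurable M"
  shows "(\<lambda>x. if Cauchy (\<lambda>n. f n x) then lim (\<lambda>n. f n x) else z) \<in> borel_measurable M"
proof (rule borel_measurable_LIMSEQ_metric)
  show "(\<lambda>x. if Cauchy (\<lambda>n. f n x) then f i x else z) \<in> borel_measurable M" for i
    by measurable
  fix x
  show "(\<lambda>i. if Cauchy (\<lambda>n. f n x) then f i x else z)
      \<longlonglongrightarrow> (if Cauchy (\<lambda>n. f n x) then lim (\<lambda>n. f n x) else z)"
    using Cauchy_convergent_iff convergent_LIMSEQ_iff by auto
qed

text \<open>
  Prokhorov's and Skorohod's theorems in one: along a subsequence, tight laws on a Polish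
  space are the laws of almost surely convergent random variables. Tightness is asked in its
  totally bounded form, with balls of each fixed radius, and only eventually in \<open>n\<close>.

  Everything is transported to the real line, where Helly's selection theorem and
  Skorohod's theorem apply. A point \<open>z\<close> is described by the bits ``\<open>z\<close> lies within \<open>2^-m\<close> of
  the \<open>i\<close>-th point of a dense sequence'', and these bits are packed into one real number of the
  Cantor set. The codes stay in \<open>[0, 1]\<close>, hence are tight for free. If the codes converge, all
  bits stabilise; tightness on the original space ensures that for each \<open>m\<close> some bit stabilises
  to true. The decoded points then eventually share a ball of radius \<open>2^-m\<close>, and
  completeness gives their limit.
\<close>

lemma skorohod_subsequence:
  fixes M :: "nat \<Rightarrow> 'z::{complete_space, second_countable_topology} measure"
  assumes M: "\<And>n. M n \<in> borel_probs"
    and tight: "\<And>\<epsilon> \<delta>::real. 0 < \<epsilon> \<Longrightarrow> 0 < \<delta> \<Longrightarrow>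
      \<exists>F. finite F \<and> (\<forall>\<^sub>F n in sequentially. measure (M n) (- (\<Union>q\<in>F. ball q \<delta>)) \<le> \<epsilon>)"
  obtains r :: "nat \<Rightarrow> nat" and \<Omega> :: "real measure" and Z Z\<^sub>0
  where "strict_mono r" "prob_space \<Omega>" "\<And>n. Z n \<in> borel_measurable \<Omega>"
    "\<And>n. distr \<Omega> borel (Z n) = M (r n)" "Z\<^sub>0 \<in> borel_measurable \<Omega>"
    "AE \<omega> in \<Omega>. (\<lambda>n. Z n \<omega>) \<longlonglongrightarrow> Z\<^sub>0 \<omega>"
proof -
  have prob_M: "prob_space (M n)" and sets_M [measurable_cong]: "sets (M n) = sets borel" for n
    using M[of n] by (auto simp: borel_probs_def)
  have space_M [simp]: "space (M n) = UNIV" for n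
    using sets_eq_imp_space_eq[OF sets_M[of n]] by simp
  obtain q :: "nat \<Rightarrow> 'z" where q: "\<And>x e. 0 < e \<Longrightarrow> \<exists>i. dist x (q i) < e"
    by (rule countable_dense_sequence) blast
  define bit :: "'z \<Rightarrow> nat \<Rightarrow> bool" where
    "bit z k \<longleftrightarrow> dist z (q (snd (prod_decode k))) < (1/2) ^ fst (prod_decode k)" for z k
  have bit_encode: "bit z (prod_encode (m, i)) \<longleftrightarrow> dist z (q i) < (1/2) ^ m" for z m i
    by (simp add: bit_def)
  define enc where "enc z = cantor_code (bit z)" for z
  have enc_measurable [measurable]: "enc \<in> borel_measurable borel"
    unfolding enc_def bit_def by measurable
  \<comment> \<open>Decoding: at scale \<open>m\<close> take the first dense point whose bit is set; these points converge
    to the coded point.\<close>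
  define centre where
    "centre m t = q (LEAST i. cantor_digit (prod_encode (m, i)) t)" for m t
  have centre_measurable [measurable]: "centre m \<in> borel_measurable borel" for m
    unfolding centre_def by measurable
  define dec where
    "dec t = (if Cauchy (\<lambda>m. centre m t) then lim (\<lambda>m. centre m t) else q 0)" for t
  have dec_measurable [measurable]: "dec \<in> borel_measurable borel"
    unfolding dec_def by (rule borel_measurable_lim_if_Cauchy) measurable
  have dec_enc: "dec (enc z) = z" for z
  proof -
    have "dist (centre m (enc z)) z < (1/2) ^ m" for m
    proof -
      have "\<exists>i. cantor_digit (prod_encode (m, i)) (enc z)"
        unfolding enc_def cantor_digit_code bit_encode using q[of "(1/2)^m" z] by simp
      then have "cantor_digit (prod_encode (m, LEAST i. cantor_digit (prod_encode (m, i)) (enc z))) (enc z)"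
        by (rule LeastI_ex)
      then show ?thesis
        unfolding centre_def by (simp add: enc_def cantor_digit_code bit_encode dist_commute)
    qed
    then have "norm (dist (centre m (enc z)) z) \<le> (1/2) ^ m" for m
      by (simp add: less_imp_le)
    then have "(\<lambda>m. dist (centre m (enc z)) z) \<longlonglongrightarrow> 0"
      by (rule Lim_null_comparison[OF always_eventually[OF allI] LIMSEQ_power_zero]) simp
    then have lim: "(\<lambda>m. centre m (enc z)) \<longlonglongrightarrow> z"
      by (subst tendsto_dist_iff)
    show ?thesis
      unfolding dec_def using LIMSEQ_imp_Cauchy[OF lim] limI[OF lim] by simp
  qed
  define \<mu> where "\<mu> n = distr (M n) borel enc" for n
  have \<mu>: "real_distribution (\<mu> n)" for n
    unfolding \<mu>_def using prob_space.real_distribution_distr[OF prob_M[of n], of enc] by simp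
  have "tight \<mu>"
    unfolding tight_def
  proof (intro conjI allI impI)
    fix \<epsilon> :: real assume "0 < \<epsilon>"
    have "measure (\<mu> n) {-1<..1} = 1" for n
    proof -
      have "-1 < enc z \<and> enc z \<le> 1" for z
        using cantor_code_bounds[of "bit z"] unfolding enc_def by linarith
      then have "enc -` {-1<..1} = UNIV" by auto
      then show ?thesis
        unfolding \<mu>_def using prob_space.prob_space[OF prob_M[of n]] by (simp add: measure_distr)
    qed
    then show "\<exists>a b. a < b \<and> (\<forall>n. measure (\<mu> n) {a<..b} > 1 - \<epsilon>)"
      using \<open>0 < \<epsilon>\<close> by (intro exI[of _ "-1"] exI[of _ 1]) auto
  qed (rule \<mu>)
  from tight_imp_convergent_subsubsequence[OF this strict_mono_id]
  obtain r \<mu>\<^sub>0 where r: "strict_mono r" and \<mu>\<^sub>0: "real_distribution \<mu>\<^sub>0"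
    and conv: "weak_conv_m (\<lambda>n. \<mu> (r n)) \<mu>\<^sub>0"
    by (auto simp: comp_def)
  from Skorohod[OF \<mu> \<mu>\<^sub>0 conv] obtain \<Omega> :: "real measure" and T T\<^sub>0 where
    \<Omega>: "prob_space \<Omega>" and T [measurable]: "\<And>n. T n \<in> borel_measurable \<Omega>"
    and distr_T: "\<And>n. distr \<Omega> borel (T n) = \<mu> (r n)"
    and T\<^sub>0 [measurable]: "T\<^sub>0 \<in> borel_measurable \<Omega>"
    and lim_T: "\<And>\<omega>. \<omega> \<in> space \<Omega> \<Longrightarrow> (\<lambda>n. T n \<omega>) \<longlonglongrightarrow> T\<^sub>0 \<omega>"
    by auto blast
  interpret \<Omega>: prob_space \<Omega> by (rule \<Omega>)
  define Z where "Z n \<omega> = dec (T n \<omega>)" for n \<omega>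
  have Z [measurable]: "Z n \<in> borel_measurable \<Omega>" for n
    unfolding Z_def by measurable
  have distr_Z: "distr \<Omega> borel (Z n) = M (r n)" for n
  proof -
    have "distr \<Omega> borel (Z n) = distr (distr \<Omega> borel (T n)) borel dec"
      by (subst distr_distr) (auto simp: Z_def[abs_def] comp_def)
    also have "\<dots> = distr (M (r n)) borel (\<lambda>z. dec (enc z))"
      unfolding distr_T \<mu>_def by (subst distr_distr) (auto simp: comp_def)
    also have "\<dots> = M (r n)"
      by (simp add: dec_enc distr_id2 sets_M)
    finally show ?thesis .
  qed
  have enc_Z: "AE \<omega> in \<Omega>. \<forall>n. enc (Z n \<omega>) = T n \<omega>"
  proof (subst AE_all_countable, intro allI)
    fix n
    have "AE t in \<mu> (r n). enc (dec t) = t"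
      unfolding \<mu>_def by (subst AE_distr_iff) (auto simp: dec_enc)
    then show "AE \<omega> in \<Omega>. enc (Z n \<omega>) = T n \<omega>"
      unfolding distr_T[symmetric] Z_def by (subst (asm) AE_distr_iff) auto
  qed
  have digits: "AE \<omega> in \<Omega>. \<forall>k. \<forall>\<^sub>F n in sequentially. bit (Z n \<omega>) k \<longleftrightarrow> cantor_digit k (T\<^sub>0 \<omega>)"
    using enc_Z AE_space
  proof eventually_elim
    case (elim \<omega>)
    then have "(\<lambda>n. cantor_code (bit (Z n \<omega>))) \<longlonglongrightarrow> T\<^sub>0 \<omega>"
      using lim_T[of \<omega>] by (simp add: enc_def)
    from cantor_digits_stabilise[OF this] show ?case by simp
  qed
  \<comment> \<open>At the limit some bit of each scale \<open>m\<close> is set almost surely: otherwise, eventually, the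
    decoded point avoids any prescribed finite family of balls, an event of small probability.\<close>
  have located: "AE \<omega> in \<Omega>. \<exists>i. cantor_digit (prod_encode (m, i)) (T\<^sub>0 \<omega>)" for m
  proof -
    define A where "A = {\<omega>\<in>space \<Omega>. \<forall>i. \<not> cantor_digit (prod_encode (m, i)) (T\<^sub>0 \<omega>)}"
    have A [measurable]: "A \<in> sets \<Omega>" unfolding A_def by measurable
    have "emeasure \<Omega> A \<le> ennreal \<epsilon>" if "0 < \<epsilon>" for \<epsilon>
    proof -
      obtain F where F: "finite F"
        and small: "\<forall>\<^sub>F n in sequentially. measure (M n) (- (\<Union>x\<in>F. ball x ((1/2)^Suc m))) \<le> \<epsilon>"
        using tight[OF \<open>0 < \<epsilon>\<close>, of "(1/2)^Suc m"] by auto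
      define V where "V = - (\<Union>x\<in>F. ball x ((1/2)^Suc m))"
      have V [measurable]: "V \<in> sets borel"
        unfolding V_def by (intro borel_comp borel_open open_UN) auto
      \<comment> \<open>Halving the radius leaves room for moving the centres to the dense sequence.\<close>
      obtain j where j: "\<And>x. dist x (q (j x)) < (1/2)^Suc m"
        using q[of "(1/2)^Suc m"] by (metis half_gt_zero_iff zero_less_one zero_less_power)
      have "AE \<omega> in \<Omega>. indicator A \<omega> \<le> liminf (\<lambda>n. indicator V (Z n \<omega>) :: ennreal)"
        using digits
      proof eventually_elim
        case (elim \<omega>)
        show ?case
        proof (cases "\<omega> \<in> A")
          case True
          then have "\<forall>\<^sub>F n in sequentially. \<not> bit (Z n \<omega>) (prod_encode (m, j x))" for x
            using spec[OF elim, of "prod_encode (m, j x)"] by (simp add: A_def)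
          then have "\<forall>\<^sub>F n in sequentially. \<forall>x\<in>F. \<not> bit (Z n \<omega>) (prod_encode (m, j x))"
            using F by (simp add: eventually_ball_finite_distrib)
          then have "\<forall>\<^sub>F n in sequentially. indicator A \<omega> \<le> (indicator V (Z n \<omega>) :: ennreal)"
          proof eventually_elim
            case (elim n)
            have "Z n \<omega> \<in> V"
            proof (rule ccontr)
              assume "Z n \<omega> \<notin> V"
              then obtain x where "x \<in> F" "dist x (Z n \<omega>) < (1/2)^Suc m"
                by (auto simp: V_def)
              then have "dist (Z n \<omega>) (q (j x)) < (1/2)^m"
                using dist_triangle[of "Z n \<omega>" "q (j x)" x] j[of x] by (simp add: dist_commute)
              then show False using elim \<open>x \<in> F\<close> by (simp add: bit_encode)
            qed
            then show ?case by (simp split: split_indicator)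
          qed
          then show ?thesis by (rule Liminf_bounded)
        qed simp
      qed
      then have "(\<integral>\<^sup>+\<omega>. indicator A \<omega> \<partial>\<Omega>) \<le> (\<integral>\<^sup>+\<omega>. liminf (\<lambda>n. indicator V (Z n \<omega>)) \<partial>\<Omega>)"
        by (rule nn_integral_mono_AE)
      also have "\<dots> \<le> liminf (\<lambda>n. \<integral>\<^sup>+\<omega>. indicator V (Z n \<omega>) \<partial>\<Omega>)"
        by (rule nn_integral_liminf) measurable
      also have "(\<lambda>n. \<integral>\<^sup>+\<omega>. indicator V (Z n \<omega>) \<partial>\<Omega>) = (\<lambda>n. emeasure (M (r n)) V)"
      proof
        fix n
        have "(\<integral>\<^sup>+\<omega>. indicator V (Z n \<omega>) \<partial>\<Omega>) = (\<integral>\<^sup>+z. indicator V z \<partial>distr \<Omega> borel (Z n))"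
          by (subst nn_integral_distr) auto
        then show "(\<integral>\<^sup>+\<omega>. indicator V (Z n \<omega>) \<partial>\<Omega>) = emeasure (M (r n)) V"
          by (simp add: distr_Z sets_M)
      qed
      also have "liminf (\<lambda>n. emeasure (M (r n)) V) \<le> ennreal \<epsilon>"
      proof (rule order.trans[OF Liminf_le_Limsup Limsup_bounded])
        show "\<forall>\<^sub>F n in sequentially. emeasure (M (r n)) V \<le> ennreal \<epsilon>"
          using eventually_subseq[OF r small[folded V_def]]
          by eventually_elim
            (simp add: finite_measure.emeasure_eq_measure[OF prob_space.finite_measure[OF prob_M]] ennreal_leI)
      qed simp
      finally show ?thesis by simp
    qed
    then have "emeasure \<Omega> A \<le> 0"
      by - (rule ennreal_le_epsilon, simp)
    then show ?thesis
      by (intro AE_I[where N=A] A) (auto simp: A_def)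
  qed
  define Z\<^sub>0 where "Z\<^sub>0 \<omega> = (if Cauchy (\<lambda>n. Z n \<omega>) then lim (\<lambda>n. Z n \<omega>) else q 0)" for \<omega>
  have Z\<^sub>0: "Z\<^sub>0 \<in> borel_measurable \<Omega>"
    unfolding Z\<^sub>0_def by (rule borel_measurable_lim_if_Cauchy) measurable
  have "AE \<omega> in \<Omega>. \<forall>m. \<exists>i. cantor_digit (prod_encode (m, i)) (T\<^sub>0 \<omega>)"
    using located by (simp add: AE_all_countable)
  with digits have "AE \<omega> in \<Omega>. (\<lambda>n. Z n \<omega>) \<longlonglongrightarrow> Z\<^sub>0 \<omega>"
  proof eventually_elim
    case (elim \<omega>)
    have "Cauchy (\<lambda>n. Z n \<omega>)"
      unfolding metric_Cauchy_iff2
    proof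
      fix j
      obtain m where m: "(1/2::real)^m < inverse (real (Suc j)) / 2"
        using real_arch_pow_inv[of "inverse (real (Suc j)) / 2" "1/2"] by auto
      obtain i where "cantor_digit (prod_encode (m, i)) (T\<^sub>0 \<omega>)"
        using elim(2) by blast
      then have "\<forall>\<^sub>F n in sequentially. dist (Z n \<omega>) (q i) < (1/2)^m"
        using spec[OF elim(1), of "prod_encode (m, i)"] by (simp add: bit_encode)
      then obtain N where N: "\<And>n. N \<le> n \<Longrightarrow> dist (Z n \<omega>) (q i) < (1/2)^m"
        unfolding eventually_sequentially by blast
      have "dist (Z a \<omega>) (Z b \<omega>) < inverse (real (Suc j))" if "N \<le> a" "N \<le> b" for a b
        using dist_triangle2[of "Z a \<omega>" "Z b \<omega>" "q i"] N[OF that(1)] N[OF that(2)] m by linarith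
      then show "\<exists>K. \<forall>a\<ge>K. \<forall>b\<ge>K. dist (Z a \<omega>) (Z b \<omega>) < inverse (real (Suc j))"
        by blast
    qed
    then show ?case
      by (simp add: Z\<^sub>0_def Cauchy_convergent_iff convergent_LIMSEQ_iff)
  qed
  with r \<Omega> Z distr_Z Z\<^sub>0 show thesis by (rule that)
qed

section \<open>Lower semicontinuous functions and Borel probability measures\<close>

text \<open>
  The value at the point itself satisfies the strict inequality, so the
  punctured neighbourhood given by the limit inferior can be completed to a full one.
\<close>

lemma lower_semicontinuous_open_superlevel:
  assumes "lower_semicontinuous f"
  shows "open {x. a < f x}"
proof (subst open_subopen, safe)
  fix x assume x: "a < f x"
  have "f x \<le> Liminf (at x) f"
    using assms by (simp add: lower_semicontinuous_def)
  then have "\<forall>\<^sub>F y in at x. a < f y"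
    using x by (simp add: le_Liminf_iff)
  then obtain S where "open S" "x \<in> S" "\<And>y. y \<in> S \<Longrightarrow> y \<noteq> x \<Longrightarrow> a < f y"
    by (auto simp: eventually_at_topological)
  then show "\<exists>T. open T \<and> x \<in> T \<and> T \<subseteq> {x. a < f x}"
    using x by (intro exI[of _ S]) blast
qed

lemma lower_semicontinuous_borel_measurable:
  "lower_semicontinuous f \<Longrightarrow> f \<in> borel_measurable borel"
  by (rule borel_measurableI_greater)
    (simp add: lower_semicontinuous_open_superlevel borel_open)

lemma lower_semicontinuous_le_liminf:
  assumes "lower_semicontinuous f" "X \<longlonglongrightarrow> x"
  shows "f x \<le> liminf (\<lambda>n. f (X n))"
  unfolding le_Liminf_iff
proof safe
  fix y assume "y < f x"
  then show "\<forall>\<^sub>F n in sequentially. y < f (X n)"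
    using topological_tendstoD[OF assms(2) lower_semicontinuous_open_superlevel[OF assms(1)]] by simp
qed

lemma lower_semicontinuous_min:
  assumes "lower_semicontinuous f"
  shows "lower_semicontinuous (\<lambda>x. min (f x) k)"
  unfolding lower_semicontinuous_def le_Liminf_iff
proof safe
  fix x y assume y: "y < min (f x) k"
  have "f x \<le> Liminf (at x) f"
    using assms by (simp add: lower_semicontinuous_def)
  then have "\<forall>\<^sub>F z in at x. y < f z"
    using y by (simp add: le_Liminf_iff)
  then show "\<forall>\<^sub>F z in at x. y < min (f z) k"
    by eventually_elim (use y in simp)
qed

lemma liminf_add_le_ennreal:
  fixes f g :: "nat \<Rightarrow> ennreal"
  shows "liminf f + liminf g \<le> liminf (\<lambda>n. f n + g n)"
proof -
  have inc: "incseq (\<lambda>n. INF m\<in>{n..}. h m)" for h :: "nat \<Rightarrow> ennreal"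
    unfolding incseq_def by (intro allI impI INF_superset_mono) auto
  have "liminf f + liminf g = (SUP n. (INF m\<in>{n..}. f m) + (INF m\<in>{n..}. g m))"
    unfolding liminf_SUP_INF by (intro ennreal_SUP_add[symmetric] inc)
  also have "\<dots> \<le> liminf (\<lambda>n. f n + g n)"
    unfolding liminf_SUP_INF by (intro SUP_mono' INF_greatest add_mono INF_lower)
  finally show ?thesis .
qed

lemma borel_probs_prob_space: "M \<in> borel_probs \<Longrightarrow> prob_space M"
  by (simp add: borel_probs_def)

lemma borel_probs_sets: "M \<in> borel_probs \<Longrightarrow> sets M = sets borel"
  by (simp add: borel_probs_def)

lemma borel_probs_space: "M \<in> borel_probs \<Longrightarrow> space M = UNIV"
  using sets_eq_imp_space_eq[OF borel_probs_sets] by simp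

lemma borel_probs_distr:
  assumes "prob_space M" "f \<in> borel_measurable M"
  shows "distr M borel f \<in> borel_probs"
  using assms by (simp add: borel_probs_def prob_space.prob_space_distr)

text \<open>
  A one-sided comparison on neighbourhoods suffices: letting \<open>\<delta>\<close> shrink around a closed set gives
  \<open>M A \<le> N A\<close> for closed \<open>A\<close>; complements give the reverse inequality for open sets, which are
  increasing unions of closed ones.
\<close>

lemma borel_probs_eqI:
  fixes M N :: "'a::metric_space measure"
  assumes M: "M \<in> borel_probs" and N: "N \<in> borel_probs"
    and le: "\<And>G \<delta>. open G \<Longrightarrow> 0 < \<delta> \<Longrightarrow> emeasure M G \<le> emeasure N (\<Union>x\<in>G. ball x \<delta>)"
  shows "M = N"
proof -
  interpret M: prob_space M using M by (rule borel_probs_prob_space)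
  interpret N: prob_space N using N by (rule borel_probs_prob_space)
  note sets [simp] = borel_probs_sets[OF M] borel_probs_sets[OF N]
  note space [simp] = borel_probs_space[OF M] borel_probs_space[OF N]
  have closed_le: "emeasure M A \<le> emeasure N A" if A: "closed A" for A
  proof -
    define T where "T k = (\<Union>x\<in>A. ball x (inverse (real (Suc k))))" for k
    have dec: "decseq T"
      unfolding decseq_def T_def
      by (intro allI impI UN_mono subset_ball) (simp_all add: le_imp_inverse_le)
    have "(\<Inter>k. T k) = A"
    proof safe
      fix x assume x: "x \<in> (\<Inter>k. T k)"
      have "\<exists>a\<in>A. dist a x < e" if e: "0 < e" for e
      proof -
        obtain k where "inverse (real (Suc k)) < e"
          using reals_Archimedean[OF e] by blast
        moreover obtain a where "a \<in> A" "dist a x < inverse (real (Suc k))"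
          using x by (auto simp: T_def)
        ultimately show ?thesis by (intro bexI[of _ a]) auto
      qed
      then have "x \<in> closure A" by (simp add: closure_approachable)
      then show "x \<in> A" using A by simp
    next
      fix x k assume "x \<in> A"
      then show "x \<in> T k" unfolding T_def by (intro UN_I[of x]) simp_all
    qed
    then have lim: "(\<lambda>k. emeasure N (T k)) \<longlonglongrightarrow> emeasure N A"
      using Lim_emeasure_decseq[of T N] dec by (auto simp: T_def intro!: borel_open)
    have "emeasure M A \<le> emeasure N (T k)" for k
    proof -
      let ?d = "inverse (real (Suc k)) / 2"
      let ?G = "\<Union>x\<in>A. ball x ?d"
      have "emeasure M A \<le> emeasure M ?G"
        by (intro emeasure_mono) (auto intro!: borel_open)
      also have "\<dots> \<le> emeasure N (\<Union>x\<in>?G. ball x ?d)"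
        by (rule le) auto
      also have "\<dots> \<le> emeasure N (T k)"
      proof (rule emeasure_mono)
        show "(\<Union>x\<in>?G. ball x ?d) \<subseteq> T k"
        proof safe
          fix x y z assume *: "x \<in> A" "y \<in> ball x ?d" "z \<in> ball y ?d"
          then have "dist x z < inverse (real (Suc k))"
            using dist_triangle[of x z y] by simp
          with * show "z \<in> T k" by (auto simp: T_def)
        qed
      qed (auto simp: T_def intro!: borel_open)
      finally show ?thesis .
    qed
    then show ?thesis by (intro LIMSEQ_le_const[OF lim]) auto
  qed
  have open_eq: "emeasure M U = emeasure N U" if U: "open U" for U
  proof (rule antisym)
    have "measure M (- U) \<le> measure N (- U)"
      using closed_le[OF closed_Compl[OF U]] by (simp add: M.emeasure_eq_measure N.emeasure_eq_measure)
    moreover have "measure M (- U) = 1 - measure M U" "measure N (- U) = 1 - measure N U"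
      using M.prob_compl[of U] N.prob_compl[of U] U by (simp_all add: Compl_eq_Diff_UNIV borel_open)
    ultimately show "emeasure N U \<le> emeasure M U"
      by (simp add: M.emeasure_eq_measure N.emeasure_eq_measure ennreal_leI)
    define B where "B k = - (\<Union>x\<in>- U. ball x (inverse (real (Suc k))))" for k
    have inc: "incseq B"
      unfolding incseq_def B_def
      by (intro allI impI compl_mono UN_mono subset_ball) (simp_all add: le_imp_inverse_le)
    have B: "closed (B k)" for k unfolding B_def by auto
    have "(\<Union>k. B k) = U"
    proof safe
      fix x assume "x \<in> U"
      then obtain e where e: "0 < e" "ball x e \<subseteq> U"
        using U openE by blast
      obtain k where k: "inverse (real (Suc k)) < e"
        using reals_Archimedean[OF e(1)] by blast
      have "x \<in> B k"
      proof (rule ccontr)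
        assume "x \<notin> B k"
        then obtain a where "a \<notin> U" "dist a x < inverse (real (Suc k))"
          by (auto simp: B_def)
        then show False using e(2) k by (auto simp: subset_eq dist_commute)
      qed
      then show "x \<in> (\<Union>k. B k)" by blast
    next
      fix x k assume x: "x \<in> B k"
      show "x \<in> U"
      proof (rule ccontr)
        assume "x \<notin> U"
        then have "x \<in> (\<Union>y\<in>- U. ball y (inverse (real (Suc k))))"
          by (intro UN_I[of x]) simp_all
        then show False using x by (simp add: B_def)
      qed
    qed
    then have SUP: "(SUP k. emeasure N (B k)) = emeasure N U" "(SUP k. emeasure M (B k)) = emeasure M U"
      using SUP_emeasure_incseq[of B N] SUP_emeasure_incseq[of B M] inc B by (auto intro!: borel_closed)
    show "emeasure M U \<le> emeasure N U"
      unfolding SUP[symmetric] by (intro SUP_mono') (rule closed_le[OF B])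
  qed
  show ?thesis
  proof (rule measure_eqI_generator_eq[where E="{U. open U}" and \<Omega>=UNIV and A="\<lambda>_. UNIV"])
    show "Int_stable {U::'a set. open U}"
      by (auto simp: Int_stable_def)
    show "sets M = sigma_sets UNIV {U. open U}" "sets N = sigma_sets UNIV {U. open U}"
      by (simp_all add: borel_def)
  qed (auto simp: open_eq)
qed

section \<open>Gluing a coupling to a plan\<close>

text \<open>
  A point is assigned to the first element of a dense sequence within distance \<open>\<delta> / 2\<close>; the cells
  are the fibres of this assignment.
\<close>

lemma countable_borel_partition:
  assumes "0 < \<delta>"
  obtains \<kappa> :: "'a::{metric_space, second_countable_topology} \<Rightarrow> nat"
  where "\<kappa> \<in> measurable borel (count_space UNIV)" "\<And>x y. \<kappa> x = \<kappa> y \<Longrightarrow> dist x y < \<delta>"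
proof -
  obtain q :: "nat \<Rightarrow> 'a" where q: "\<And>x e. 0 < e \<Longrightarrow> \<exists>i. dist x (q i) < e"
    by (rule countable_dense_sequence) blast
  define \<kappa> where "\<kappa> x = (LEAST i. dist x (q i) < \<delta> / 2)" for x
  have near: "dist x (q (\<kappa> x)) < \<delta> / 2" for x
    unfolding \<kappa>_def by (rule LeastI_ex) (rule q, use assms in simp)
  have "dist x y < \<delta>" if "\<kappa> x = \<kappa> y" for x y
    using near[of x] near[of y] that dist_triangle2[of x y "q (\<kappa> x)"] by simp
  moreover have "\<kappa> \<in> measurable borel (count_space UNIV)"
    unfolding \<kappa>_def by measurable
  ultimately show thesis by (rule that[rotated])
qed

lemma measurable_pred_nat_eq:
  fixes f g :: "'a \<Rightarrow> nat"
  assumes [measurable]: "f \<in> measurable M (count_space UNIV)" "g \<in> measurable M (count_space UNIV)"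
  shows "Measurable.pred M (\<lambda>x. f x = g x)"
proof -
  have "(f x = g x) = (\<exists>i. f x = i \<and> g x = i)" for x by auto
  moreover have "Measurable.pred M (\<lambda>x. \<exists>i. f x = i \<and> g x = i)"
    by measurable
  ultimately show ?thesis by presburger
qed

text \<open>
  The mass of a cell depends on \<open>N\<close> only through its marginal, and almost every point lies in a
  cell of positive mass, which makes division by cell masses harmless.
\<close>

lemma cell_mass:
  fixes \<kappa> :: "'a::topological_space \<Rightarrow> nat"
  assumes [measurable]: "fst \<in> borel_measurable N" and \<mu>: "distr N borel fst = \<mu>"
    and [measurable]: "\<kappa> \<in> measurable borel (count_space UNIV)"
  shows "(\<integral>\<^sup>+p. (if \<kappa> (fst p) = i then 1 else 0) \<partial>N) = emeasure \<mu> {x. \<kappa> x = i}"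
    and "AE p in N. emeasure \<mu> {x. \<kappa> x = \<kappa> (fst p)} \<noteq> 0"
proof -
  have mass: "(\<integral>\<^sup>+p. (if \<kappa> (fst p) = i then 1 else 0) \<partial>N) = emeasure \<mu> {x. \<kappa> x = i}" for i
  proof -
    have "(\<integral>\<^sup>+p. (if \<kappa> (fst p) = i then 1 else 0) \<partial>N) = (\<integral>\<^sup>+x. indicator {x. \<kappa> x = i} x \<partial>\<mu>)"
      unfolding \<mu>[symmetric] by (subst nn_integral_distr) (auto intro!: nn_integral_cong)
    also have "\<dots> = emeasure \<mu> {x. \<kappa> x = i}"
      unfolding \<mu>[symmetric] by (intro nn_integral_indicator) measurable
    finally show ?thesis .
  qed
  then show "(\<integral>\<^sup>+p. (if \<kappa> (fst p) = i then 1 else 0) \<partial>N) = emeasure \<mu> {x. \<kappa> x = i}" .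
  have "AE p in N. emeasure \<mu> {x. \<kappa> x = i} = 0 \<longrightarrow> \<kappa> (fst p) \<noteq> i" for i
  proof (cases "emeasure \<mu> {x. \<kappa> x = i} = 0")
    case True
    then have "(\<integral>\<^sup>+p. (if \<kappa> (fst p) = i then 1 else 0) \<partial>N) = 0"
      by (simp only: mass)
    then have "AE p in N. (if \<kappa> (fst p) = i then 1 else 0 :: ennreal) = 0"
      by (subst (asm) nn_integral_0_iff_AE) auto
    then show ?thesis by eventually_elim (auto split: if_splits)
  qed simp
  then have "AE p in N. \<forall>i. emeasure \<mu> {x. \<kappa> x = i} = 0 \<longrightarrow> \<kappa> (fst p) \<noteq> i"
    by (simp add: AE_all_countable)
  then show "AE p in N. emeasure \<mu> {x. \<kappa> x = \<kappa> (fst p)} \<noteq> 0"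
    by eventually_elim auto
qed

text \<open>
  The two copies of \<open>x\<^sub>0\<close> in \<open>\<pi>\<close> and \<open>\<gamma>\<close> are forced into the same cell, so that they differ by
  less than \<open>\<epsilon>\<close>. This is achieved by a density with respect to \<open>\<pi> \<Otimes>\<^sub>M \<gamma>\<close>: the indicator of the same-cell event divided by the mass
  of that cell. Both \<open>\<pi>\<close> and \<open>\<gamma>\<close> remain exact marginals, because they give each cell
  the same mass.
\<close>

lemma approximate_gluing:
  fixes \<mu>\<^sub>0 \<mu>\<^sub>1 :: "'a::{metric_space, second_countable_topology} measure"
    and \<gamma> :: "('a \<times> 'b::second_countable_topology) measure"
  assumes \<pi>: "\<pi> \<in> couplings \<mu>\<^sub>0 \<mu>\<^sub>1" and \<gamma>: "\<gamma> \<in> probs_with_fst_marginal \<mu>\<^sub>0" and \<epsilon>: "0 < \<epsilon>"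
  obtains \<alpha> :: "('a \<times> 'a \<times> 'b) measure"
  where "\<alpha> \<in> borel_probs" "distr \<alpha> borel fst = \<mu>\<^sub>1" "distr \<alpha> borel snd = \<gamma>"
    "(\<integral>\<^sup>+(x\<^sub>1, x\<^sub>0, y). ennreal (dist x\<^sub>1 x\<^sub>0) \<partial>\<alpha>)
      \<le> (\<integral>\<^sup>+(x\<^sub>0, x\<^sub>1). ennreal (dist x\<^sub>0 x\<^sub>1) \<partial>\<pi>) + ennreal \<epsilon>"
proof -
  have \<pi>': "\<pi> \<in> borel_probs" "distr \<pi> borel fst = \<mu>\<^sub>0" "distr \<pi> borel snd = \<mu>\<^sub>1"
    using \<pi> by (auto simp: couplings_def)
  have \<gamma>': "\<gamma> \<in> borel_probs" "distr \<gamma> borel fst = \<mu>\<^sub>0"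
    using \<gamma> by (auto simp: probs_with_fst_marginal_def)
  have [measurable_cong]: "sets \<pi> = sets (borel \<Otimes>\<^sub>M borel)" "sets \<gamma> = sets (borel \<Otimes>\<^sub>M borel)"
    unfolding borel_prod by (rule borel_probs_sets[OF \<pi>'(1)] borel_probs_sets[OF \<gamma>'(1)])+
  interpret \<pi>: prob_space \<pi> using \<pi>'(1) by (rule borel_probs_prob_space)
  interpret \<gamma>: prob_space \<gamma> using \<gamma>'(1) by (rule borel_probs_prob_space)
  interpret P: pair_prob_space \<pi> \<gamma> ..
  obtain \<kappa> :: "'a \<Rightarrow> nat" where \<kappa> [measurable]: "\<kappa> \<in> measurable borel (count_space UNIV)"
    and \<kappa>_near: "\<And>x y. \<kappa> x = \<kappa> y \<Longrightarrow> dist x y < \<epsilon>"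
    using countable_borel_partition[OF \<epsilon>] by metis
  define m where "m i = emeasure \<mu>\<^sub>0 {x. \<kappa> x = i}" for i
  have m_\<pi>: "(\<integral>\<^sup>+p. (if \<kappa> (fst p) = i then 1 else 0) \<partial>\<pi>) = m i" for i
    unfolding m_def by (rule cell_mass(1)[OF _ \<pi>'(2) \<kappa>]) measurable
  have m_\<gamma>: "(\<integral>\<^sup>+z. (if \<kappa> (fst z) = i then 1 else 0) \<partial>\<gamma>) = m i" for i
    unfolding m_def by (rule cell_mass(1)[OF _ \<gamma>'(2) \<kappa>]) measurable
  have m_finite: "m i \<noteq> \<top>" for i
    unfolding m_def \<gamma>'(2)[symmetric] by (simp add: emeasure_distr)
  have \<pi>_charged: "AE p in \<pi>. m (\<kappa> (fst p)) \<noteq> 0"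
    unfolding m_def by (rule cell_mass(2)[OF _ \<pi>'(2) \<kappa>]) measurable
  have \<gamma>_charged: "AE z in \<gamma>. m (\<kappa> (fst z)) \<noteq> 0"
    unfolding m_def by (rule cell_mass(2)[OF _ \<gamma>'(2) \<kappa>]) measurable
  define v where "v i = inverse (m i)" for i
  define u where "u x = v (\<kappa> x)" for x
  have [measurable]: "u \<in> borel_measurable borel"
    unfolding u_def by (rule measurable_compose[OF \<kappa>]) simp
  define g where "g p z = (if \<kappa> (fst z) = \<kappa> (fst p) then 1 else 0) * u (fst p)"
    for p :: "'a \<times> 'a" and z :: "'a \<times> 'b"
  have g_measurable [measurable]: "(\<lambda>(p, z). g p z) \<in> borel_measurable (\<pi> \<Otimes>\<^sub>M \<gamma>)"
  proof -
    have [measurable]: "Measurable.pred (\<pi> \<Otimes>\<^sub>M \<gamma>) (\<lambda>w. \<kappa> (fst (snd w)) = \<kappa> (fst (fst w)))"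
      by (rule measurable_pred_nat_eq) measurable
    show ?thesis unfolding g_def case_prod_beta by measurable
  qed
  have v_m: "m i * v i = 1" if "m i \<noteq> 0" for i
    using that m_finite[of i] ennreal_divide_self[of "m i"] by (simp add: v_def divide_ennreal_def less_top)
  define D where "D = density (\<pi> \<Otimes>\<^sub>M \<gamma>) (\<lambda>(p, z). g p z)"
  have D_sets [measurable_cong]: "sets D = sets (\<pi> \<Otimes>\<^sub>M \<gamma>)"
    by (simp add: D_def)
  have D_fst: "(\<integral>\<^sup>+w. f (fst w) \<partial>D) = (\<integral>\<^sup>+p. f p \<partial>\<pi>)"
    if [measurable]: "f \<in> borel_measurable \<pi>" for f :: "'a \<times> 'a \<Rightarrow> ennreal"
  proof -
    have "(\<integral>\<^sup>+w. f (fst w) \<partial>D) = (\<integral>\<^sup>+p. \<integral>\<^sup>+z. g p z * f p \<partial>\<gamma> \<partial>\<pi>)"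
      unfolding D_def by (simp add: nn_integral_density \<gamma>.nn_integral_fst[symmetric] case_prod_beta)
    also have "\<dots> = (\<integral>\<^sup>+p. f p \<partial>\<pi>)"
    proof (rule nn_integral_cong_AE)
      show "AE p in \<pi>. (\<integral>\<^sup>+z. g p z * f p \<partial>\<gamma>) = f p"
        using \<pi>_charged
      proof eventually_elim
        case (elim p)
        have "(\<integral>\<^sup>+z. g p z * f p \<partial>\<gamma>)
            = (\<integral>\<^sup>+z. (u (fst p) * f p) * (if \<kappa> (fst z) = \<kappa> (fst p) then 1 else 0) \<partial>\<gamma>)"
          by (intro nn_integral_cong) (simp add: g_def u_def)
        also have "\<dots> = (u (fst p) * f p) * m (\<kappa> (fst p))"
          by (subst nn_integral_cmult) (auto simp: m_\<gamma>)
        also have "\<dots> = f p"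
          using v_m[OF elim] by (simp add: u_def ac_simps mult.assoc[symmetric])
        finally show ?case .
      qed
    qed
    finally show ?thesis .
  qed
  have D_snd: "(\<integral>\<^sup>+w. f (snd w) \<partial>D) = (\<integral>\<^sup>+z. f z \<partial>\<gamma>)"
    if [measurable]: "f \<in> borel_measurable \<gamma>" for f :: "'a \<times> 'b \<Rightarrow> ennreal"
  proof -
    have "(\<integral>\<^sup>+w. f (snd w) \<partial>D) = (\<integral>\<^sup>+z. \<integral>\<^sup>+p. g p z * f z \<partial>\<pi> \<partial>\<gamma>)"
      unfolding D_def by (simp add: nn_integral_density P.nn_integral_snd[symmetric] case_prod_beta)
    also have "\<dots> = (\<integral>\<^sup>+z. f z \<partial>\<gamma>)"
    proof (rule nn_integral_cong_AE)
      show "AE z in \<gamma>. (\<integral>\<^sup>+p. g p z * f z \<partial>\<pi>) = f z"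
        using \<gamma>_charged
      proof eventually_elim
        case (elim z)
        have "(\<integral>\<^sup>+p. g p z * f z \<partial>\<pi>)
            = (\<integral>\<^sup>+p. (u (fst z) * f z) * (if \<kappa> (fst p) = \<kappa> (fst z) then 1 else 0) \<partial>\<pi>)"
          by (intro nn_integral_cong) (simp add: g_def u_def)
        also have "\<dots> = (u (fst z) * f z) * m (\<kappa> (fst z))"
          by (subst nn_integral_cmult) (auto simp: m_\<pi>)
        also have "\<dots> = f z"
          using v_m[OF elim] by (simp add: u_def ac_simps mult.assoc[symmetric])
        finally show ?case .
      qed
    qed
    finally show ?thesis .
  qed
  have "emeasure D (space D) = 1"
    using D_fst[of "\<lambda>_. 1"] by (simp add: \<pi>.emeasure_space_1)
  then interpret D: prob_space D by (rule prob_spaceI)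
  let ?t = "\<lambda>w. (snd (fst w), snd w)"
  have t [measurable]: "?t \<in> borel_measurable D"
    unfolding borel_prod[symmetric] by measurable
  define \<alpha> :: "('a \<times> 'a \<times> 'b) measure" where "\<alpha> = distr D borel ?t"
  have fst_borel [measurable]: "(fst :: 'a \<times> 'a \<times> 'b \<Rightarrow> 'a) \<in> borel_measurable borel"
    and snd_borel [measurable]: "(snd :: 'a \<times> 'a \<times> 'b \<Rightarrow> 'a \<times> 'b) \<in> borel_measurable borel"
    unfolding borel_prod[symmetric] by measurable
  have [measurable]: "(\<lambda>t::'a \<times> 'a \<times> 'b. dist (fst t) (fst (snd t))) \<in> borel_measurable borel"
    by (intro borel_measurable_continuous_onI continuous_intros)
  show thesis
  proof (rule that)
    show "\<alpha> \<in> borel_probs"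
      unfolding \<alpha>_def using t by (rule borel_probs_distr[OF D.prob_space_axioms])
    show "distr \<alpha> borel fst = \<mu>\<^sub>1"
    proof (rule measure_eqI)
      fix A assume "A \<in> sets (distr \<alpha> borel fst)"
      then have [measurable]: "A \<in> sets borel" by simp
      have "emeasure (distr \<alpha> borel fst) A = (\<integral>\<^sup>+x. indicator A x \<partial>distr \<alpha> borel fst)"
        by simp
      also have "\<dots> = (\<integral>\<^sup>+w. indicator A (snd (fst w)) \<partial>D)"
        unfolding \<alpha>_def by (simp add: nn_integral_distr del: nn_integral_indicator)
      also have "\<dots> = (\<integral>\<^sup>+p. indicator A (snd p) \<partial>\<pi>)"
        by (rule D_fst) measurable
      also have "\<dots> = (\<integral>\<^sup>+x. indicator A x \<partial>\<mu>\<^sub>1)"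
        unfolding \<pi>'(3)[symmetric] by (simp add: nn_integral_distr del: nn_integral_indicator)
      also have "\<dots> = emeasure \<mu>\<^sub>1 A"
        unfolding \<pi>'(3)[symmetric] by simp
      finally show "emeasure (distr \<alpha> borel fst) A = emeasure \<mu>\<^sub>1 A" .
    qed (simp add: \<pi>'(3)[symmetric])
    show "distr \<alpha> borel snd = \<gamma>"
    proof (rule measure_eqI)
      fix A assume "A \<in> sets (distr \<alpha> borel snd)"
      then have A [measurable]: "A \<in> sets borel" "A \<in> sets \<gamma>"
        by (simp_all add: borel_probs_sets[OF \<gamma>'(1)])
      have "emeasure (distr \<alpha> borel snd) A = (\<integral>\<^sup>+x. indicator A x \<partial>distr \<alpha> borel snd)"
        by simp
      also have "\<dots> = (\<integral>\<^sup>+w. indicator A (snd w) \<partial>D)"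
        unfolding \<alpha>_def by (simp add: nn_integral_distr del: nn_integral_indicator)
      also have "\<dots> = (\<integral>\<^sup>+z. indicator A z \<partial>\<gamma>)"
        by (rule D_snd) measurable
      also have "\<dots> = emeasure \<gamma> A"
        by simp
      finally show "emeasure (distr \<alpha> borel snd) A = emeasure \<gamma> A" .
    qed (simp add: borel_probs_sets[OF \<gamma>'(1)])
    have "(\<integral>\<^sup>+(x\<^sub>1, x\<^sub>0, y). ennreal (dist x\<^sub>1 x\<^sub>0) \<partial>\<alpha>)
        = (\<integral>\<^sup>+w. ennreal (dist (snd (fst w)) (fst (snd w))) \<partial>D)"
      unfolding \<alpha>_def case_prod_beta by (subst nn_integral_distr) auto
    also have "\<dots> = (\<integral>\<^sup>+w. g (fst w) (snd w) * ennreal (dist (snd (fst w)) (fst (snd w))) \<partial>(\<pi> \<Otimes>\<^sub>M \<gamma>))"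
      unfolding D_def by (subst nn_integral_density) (auto simp: case_prod_beta)
    also have "\<dots> \<le> (\<integral>\<^sup>+w. g (fst w) (snd w) *
        (ennreal (dist (fst (fst w)) (snd (fst w))) + ennreal \<epsilon>) \<partial>(\<pi> \<Otimes>\<^sub>M \<gamma>))"
    proof (rule nn_integral_mono)
      fix w :: "('a \<times> 'a) \<times> 'a \<times> 'b"
      show "g (fst w) (snd w) * ennreal (dist (snd (fst w)) (fst (snd w)))
        \<le> g (fst w) (snd w) * (ennreal (dist (fst (fst w)) (snd (fst w))) + ennreal \<epsilon>)"
      proof (cases "\<kappa> (fst (snd w)) = \<kappa> (fst (fst w))")
        case True
        then have "dist (snd (fst w)) (fst (snd w)) \<le> dist (fst (fst w)) (snd (fst w)) + \<epsilon>"
          using \<kappa>_near[OF True] dist_triangle[of "snd (fst w)" "fst (snd w)" "fst (fst w)"]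
          by (simp add: dist_commute)
        then show ?thesis
          using \<epsilon> by (intro mult_left_mono) (auto simp flip: ennreal_plus intro: ennreal_leI)
      qed (simp add: g_def)
    qed
    also have "\<dots> = (\<integral>\<^sup>+w. (ennreal (dist (fst (fst w)) (snd (fst w))) + ennreal \<epsilon>) \<partial>D)"
      unfolding D_def by (subst nn_integral_density) (auto simp: case_prod_beta)
    also have "\<dots> = (\<integral>\<^sup>+p. (ennreal (dist (fst p) (snd p)) + ennreal \<epsilon>) \<partial>\<pi>)"
      by (rule D_fst) measurable
    also have "\<dots> = (\<integral>\<^sup>+p. ennreal (dist (fst p) (snd p)) \<partial>\<pi>) + ennreal \<epsilon>"
      by (subst nn_integral_add) (auto simp: \<pi>.emeasure_space_1)
    finally show "(\<integral>\<^sup>+(x\<^sub>1, x\<^sub>0, y). ennreal (dist x\<^sub>1 x\<^sub>0) \<partial>\<alpha>)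
      \<le> (\<integral>\<^sup>+(x\<^sub>0, x\<^sub>1). ennreal (dist x\<^sub>0 x\<^sub>1) \<partial>\<pi>) + ennreal \<epsilon>"
      by (simp add: case_prod_beta')
  qed
qed

section \<open>Discretisation by random sampling\<close>

lemma nn_integral_PiM_two_components:
  assumes M: "\<And>i. prob_space (M i)" and "i \<noteq> j"
    and f [measurable]: "f \<in> borel_measurable (M i \<Otimes>\<^sub>M M j)"
  shows "(\<integral>\<^sup>+\<omega>. f (\<omega> i, \<omega> j) \<partial>PiM UNIV M) = (\<integral>\<^sup>+x. \<integral>\<^sup>+y. f (x, y) \<partial>M j \<partial>M i)"
proof -
  define R where "R = PiM (UNIV - {i}) M"
  interpret R: prob_space R
    unfolding R_def by (intro prob_space_PiM M)
  have ins: "insert i (UNIV - {i}) = UNIV" by auto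
  have section_f: "(\<lambda>y. f (x, y)) \<in> borel_measurable (M j)" if "x \<in> space (M i)" for x
    using that by measurable
  have R_j [measurable]: "(\<lambda>X. X j) \<in> measurable R (M j)"
    unfolding R_def using \<open>i \<noteq> j\<close> by (intro measurable_component_singleton) auto
  have split: "PiM UNIV M = distr (M i \<Otimes>\<^sub>M R) (PiM UNIV M) (\<lambda>(x, X). X(i := x))"
    using distr_pair_PiM_eq_PiM[of "UNIV - {i}" M i] M unfolding ins R_def by simp
  have upd: "(\<lambda>(x, X). X(i := x)) \<in> measurable (M i \<Otimes>\<^sub>M R) (PiM UNIV M)"
    unfolding R_def case_prod_beta by (rule measurable_fun_upd[of _ "UNIV - {i}"]) auto
  have "(\<integral>\<^sup>+\<omega>. f (\<omega> i, \<omega> j) \<partial>PiM UNIV M)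
      = (\<integral>\<^sup>+w. f (fst w, snd w j) \<partial>(M i \<Otimes>\<^sub>M R))"
    by (subst split, subst nn_integral_distr[OF upd])
      (use \<open>i \<noteq> j\<close> in \<open>auto simp: case_prod_beta\<close>)
  also have "\<dots> = (\<integral>\<^sup>+x. \<integral>\<^sup>+X. f (x, X j) \<partial>R \<partial>M i)"
    by (subst R.nn_integral_fst[symmetric]) auto
  also have "\<dots> = (\<integral>\<^sup>+x. \<integral>\<^sup>+y. f (x, y) \<partial>M j \<partial>M i)"
  proof (rule nn_integral_cong)
    fix x assume x: "x \<in> space (M i)"
    have "M j = distr R (M j) (\<lambda>X. X j)"
      unfolding R_def using M \<open>i \<noteq> j\<close> by (intro distr_PiM_component[symmetric]) auto
    then have "(\<integral>\<^sup>+y. f (x, y) \<partial>M j) = (\<integral>\<^sup>+y. f (x, y) \<partial>distr R (M j) (\<lambda>X. X j))"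
      by simp
    also have "\<dots> = (\<integral>\<^sup>+X. f (x, X j) \<partial>R)"
      by (rule nn_integral_distr[OF R_j]) (simp add: section_f x)
    finally show "(\<integral>\<^sup>+X. f (x, X j) \<partial>R) = (\<integral>\<^sup>+y. f (x, y) \<partial>M j)" ..
  qed
  finally show ?thesis .
qed

text \<open>
  The first-moment method: a random variable does not exceed its mean with positive
  probability, hence somewhere in any event of full measure.
\<close>

lemma exists_le_nn_integral:
  assumes "prob_space N" and T [measurable]: "T \<in> borel_measurable N"
    and P: "AE \<omega> in N. P \<omega>"
  obtains \<omega> where "P \<omega>" "T \<omega> \<le> (\<integral>\<^sup>+\<omega>. T \<omega> \<partial>N)"
proof -
  interpret prob_space N by fact
  let ?I = "\<integral>\<^sup>+\<omega>. T \<omega> \<partial>N"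
  have "\<exists>\<omega>. P \<omega> \<and> T \<omega> \<le> ?I"
  proof (rule ccontr)
    assume "\<not> ?thesis"
    then have less: "P \<omega> \<Longrightarrow> ?I < T \<omega>" for \<omega> by (auto simp: not_le)
    have AE_less: "AE \<omega> in N. ?I < T \<omega>"
      using P by eventually_elim (rule less)
    obtain \<omega> where "P \<omega>"
    proof (rule ccontr)
      assume "\<not> thesis"
      then have "\<And>\<omega>. \<not> P \<omega>" using that by blast
      with P have "AE \<omega> in N. False" by simp
      then show False by simp
    qed
    then have finite: "?I \<noteq> \<infinity>" using less by fastforce
    have "(\<integral>\<^sup>+_. ?I \<partial>N) < ?I"
    proof (rule nn_integral_less)
      show "(\<integral>\<^sup>+_. ?I \<partial>N) \<noteq> \<infinity>" using finite by (simp add: emeasure_space_1)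
      show "AE \<omega> in N. ?I \<le> T \<omega>" using AE_less by eventually_elim (rule less_imp_le)
      show "\<not> (AE \<omega> in N. T \<omega> \<le> ?I)"
      proof
        assume "AE \<omega> in N. T \<omega> \<le> ?I"
        with AE_less have "AE \<omega> in N. False" by eventually_elim auto
        then show False by simp
      qed
    qed simp_all
    then show False by (simp add: emeasure_space_1)
  qed
  then show thesis using that by blast
qed

text \<open>
  The points \<open>p i\<close> are drawn independently, \<open>p i\<close> with law \<open>M i\<close>. For \<open>i \<noteq> j\<close> the pair \<open>(p i, p j)\<close>
  has law \<open>M i \<Otimes>\<^sub>M M j\<close>, so by the mixture property the mean of the left-hand side
  is at most the right-hand side. The diagonal must be left out, since nothing bounds
  \<open>H (x, x)\<close>.
\<close>

lemma sampling_from_mixture: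
  fixes M :: "nat \<Rightarrow> 's measure" and w :: "nat \<Rightarrow> ennreal"
  assumes M: "\<And>i. prob_space (M i)" and sets [measurable_cong]: "\<And>i. sets (M i) = sets \<alpha>"
    and \<alpha>: "prob_space \<alpha>"
    and mix: "\<And>f. f \<in> borel_measurable \<alpha> \<Longrightarrow> (\<Sum>i. w i * (\<integral>\<^sup>+x. f x \<partial>M i)) = (\<integral>\<^sup>+x. f x \<partial>\<alpha>)"
    and F [measurable]: "F \<in> borel_measurable \<alpha>" and H [measurable]: "H \<in> borel_measurable (\<alpha> \<Otimes>\<^sub>M \<alpha>)"
    and P: "\<And>i. AE x in M i. P i x"
  obtains p where "\<And>i. P i (p i)"
    "(\<Sum>i. w i * F (p i)) + (\<Sum>i. w i * (\<Sum>j. w j * (if i = j then 0 else H (p i, p j))))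
      \<le> (\<integral>\<^sup>+x. F x \<partial>\<alpha>) + (\<integral>\<^sup>+x. \<integral>\<^sup>+y. H (x, y) \<partial>\<alpha> \<partial>\<alpha>)"
proof -
  interpret M: prob_space "M i" for i by (rule M)
  interpret \<alpha>: prob_space \<alpha> by (rule \<alpha>)
  have F_i: "F \<in> borel_measurable (M i)" for i
    by measurable
  define N where "N = PiM UNIV M"
  have N: "prob_space N" unfolding N_def by (intro prob_space_PiM M)
  have comp [measurable]: "(\<lambda>\<omega>. \<omega> i) \<in> measurable N (M i)" for i
    unfolding N_def by measurable
  have comp' [measurable]: "(\<lambda>\<omega>. \<omega> i) \<in> measurable N \<alpha>" for i
    using comp[of i] measurable_cong_sets[OF refl sets[of i], of N] by simp
  have N_comp: "distr N (M i) (\<lambda>\<omega>. \<omega> i) = M i" for i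
    unfolding N_def by (rule distr_PiM_component) (auto intro: M)
  have H_ij [measurable]: "H \<in> borel_measurable (M i \<Otimes>\<^sub>M M j)" for i j
    by measurable
  define E where "E i j \<omega> = (if i = j then 0 else H (\<omega> i, \<omega> j))" for i j and \<omega> :: "nat \<Rightarrow> 's"
  have E [measurable]: "E i j \<in> borel_measurable N" for i j
    unfolding E_def by (cases "i = j") (simp_all, measurable)
  define T where "T \<omega> = (\<Sum>i. w i * F (\<omega> i)) + (\<Sum>i. w i * (\<Sum>j. w j * E i j \<omega>))" for \<omega>
  have T [measurable]: "T \<in> borel_measurable N"
    unfolding T_def by measurable
  have P_all: "AE \<omega> in N. \<forall>i. P i (\<omega> i)"
    unfolding AE_all_countable N_def by (intro allI AE_PiM_component M P) simp
  have "(\<integral>\<^sup>+\<omega>. T \<omega> \<partial>N) = (\<Sum>i. w i * (\<integral>\<^sup>+\<omega>. F (\<omega> i) \<partial>N)) + (\<Sum>i. w i * (\<Sum>j. w j * (\<integral>\<^sup>+\<omega>. E i j \<omega> \<partial>N)))"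
    unfolding T_def by (simp add: nn_integral_add nn_integral_suminf nn_integral_cmult)
  also have "(\<Sum>i. w i * (\<integral>\<^sup>+\<omega>. F (\<omega> i) \<partial>N)) = (\<integral>\<^sup>+x. F x \<partial>\<alpha>)"
  proof -
    have "(\<integral>\<^sup>+\<omega>. F (\<omega> i) \<partial>N) = (\<integral>\<^sup>+x. F x \<partial>M i)" for i
    proof -
      have "(\<integral>\<^sup>+x. F x \<partial>distr N (M i) (\<lambda>\<omega>. \<omega> i)) = (\<integral>\<^sup>+\<omega>. F (\<omega> i) \<partial>N)"
        by (rule nn_integral_distr[OF comp]) (simp add: F_i)
      then show ?thesis by (simp only: N_comp)
    qed
    then show ?thesis using mix[OF F] by simp
  qed
  also have "(\<Sum>i. w i * (\<Sum>j. w j * (\<integral>\<^sup>+\<omega>. E i j \<omega> \<partial>N))) \<le> (\<Sum>i. w i * (\<Sum>j. w j * (\<integral>\<^sup>+x. \<integral>\<^sup>+y. H (x, y) \<partial>M j \<partial>M i)))"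
  proof (intro suminf_le summableI mult_left_mono)
    show "(\<integral>\<^sup>+\<omega>. E i j \<omega> \<partial>N) \<le> (\<integral>\<^sup>+x. \<integral>\<^sup>+y. H (x, y) \<partial>M j \<partial>M i)" for i j
      using nn_integral_PiM_two_components[of M i j H] M by (cases "i = j") (simp_all add: E_def N_def)
  qed simp_all
  also have "(\<Sum>i. w i * (\<Sum>j. w j * (\<integral>\<^sup>+x. \<integral>\<^sup>+y. H (x, y) \<partial>M j \<partial>M i))) = (\<integral>\<^sup>+x. \<integral>\<^sup>+y. H (x, y) \<partial>\<alpha> \<partial>\<alpha>)"
  proof -
    have "(\<Sum>j. w j * (\<integral>\<^sup>+x. \<integral>\<^sup>+y. H (x, y) \<partial>M j \<partial>M i)) = (\<integral>\<^sup>+x. \<integral>\<^sup>+y. H (x, y) \<partial>\<alpha> \<partial>M i)" for i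
    proof -
      have "(\<Sum>j. w j * (\<integral>\<^sup>+x. \<integral>\<^sup>+y. H (x, y) \<partial>M j \<partial>M i)) = (\<integral>\<^sup>+x. (\<Sum>j. w j * (\<integral>\<^sup>+y. H (x, y) \<partial>M j)) \<partial>M i)"
        by (simp add: nn_integral_suminf nn_integral_cmult)
      also have "\<dots> = (\<integral>\<^sup>+x. \<integral>\<^sup>+y. H (x, y) \<partial>\<alpha> \<partial>M i)"
      proof (rule nn_integral_cong)
        fix x assume "x \<in> space (M i)"
        then have "x \<in> space \<alpha>" using sets_eq_imp_space_eq[OF sets] by auto
        then show "(\<Sum>j. w j * (\<integral>\<^sup>+y. H (x, y) \<partial>M j)) = (\<integral>\<^sup>+y. H (x, y) \<partial>\<alpha>)"
          by (intro mix) simp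
      qed
      finally show ?thesis .
    qed
    then show ?thesis using mix[of "\<lambda>x. \<integral>\<^sup>+y. H (x, y) \<partial>\<alpha>"] by simp
  qed
  finally have bound: "(\<integral>\<^sup>+\<omega>. T \<omega> \<partial>N) \<le> (\<integral>\<^sup>+x. F x \<partial>\<alpha>) + (\<integral>\<^sup>+x. \<integral>\<^sup>+y. H (x, y) \<partial>\<alpha> \<partial>\<alpha>)"
    by (simp add: add_left_mono)
  obtain p where "\<forall>i. P i (p i)" "T p \<le> (\<integral>\<^sup>+\<omega>. T \<omega> \<partial>N)"
    using exists_le_nn_integral[OF N T P_all] by blast
  with bound show thesis
    by (intro that[of p]) (auto simp: T_def E_def intro: order.trans)
qed

text \<open>
  The index \<open>j\<close> stands for the pair of a cell \<open>j div n\<close> and one of its \<open>n\<close> samples.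
\<close>

lemma suminf_repeat:
  fixes a :: "nat \<Rightarrow> ennreal"
  assumes "0 < n"
  shows "(\<Sum>j. a (j div n) / of_nat n) = (\<Sum>i. a i)"
proof -
  have "(\<lambda>i. \<Sum>j\<in>{i * n..<i * n + n}. a (j div n) / of_nat n) sums (\<Sum>j. a (j div n) / of_nat n)"
    by (rule sums_group[OF summable_sums[OF summableI] assms])
  moreover have "(\<Sum>j\<in>{i * n..<i * n + n}. a (j div n) / of_nat n) = a i" for i
  proof -
    have "(\<Sum>j\<in>{i * n..<i * n + n}. a (j div n) / of_nat n) = (\<Sum>j\<in>{i * n..<i * n + n}. a i / of_nat n)"
      by (intro sum.cong refl arg_cong2[where f="(/)"] arg_cong[where f=a] div_nat_eqI)
        (auto simp: mult.commute)
    also have "\<dots> = a i * of_nat n / of_nat n"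
      by (simp add: ennreal_times_divide mult.commute)
    also have "\<dots> = a i"
      using assms by (intro ennreal_mult_divide_eq) simp_all
    finally show ?thesis .
  qed
  ultimately show ?thesis by (simp add: sums_unique)
qed

text \<open>
  The measure \<open>W\<close> gives the index \<open>j\<close> the share \<open>1 / n\<close> of the mass of its cell, and the point \<open>p j\<close> is sampled
  from \<open>\<alpha>\<close> conditioned on that cell. Repeating each cell \<open>n\<close> times keeps all weights
  at most \<open>1 / n\<close>, even when \<open>\<alpha>\<close> has atoms; this is what later makes the omitted diagonal
  negligible. Cells are small only in the first coordinate, and this controls the first marginal.
\<close>

lemma discrete_approximation:
  fixes \<alpha> :: "('a::{metric_space, second_countable_topology} \<times> 't::second_countable_topology) measure"
  assumes \<alpha>: "\<alpha> \<in> borel_probs" and F: "F \<in> borel_measurable borel"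
    and H: "H \<in> borel_measurable (borel \<Otimes>\<^sub>M borel)" and "0 < n" "0 < \<delta>"
  obtains W :: "nat measure" and p :: "nat \<Rightarrow> 'a \<times> 't" where "prob_space W" "sets W = UNIV"
    "(\<integral>\<^sup>+i. F (p i) \<partial>W) + (\<integral>\<^sup>+i. \<integral>\<^sup>+j. (if i = j then 0 else H (p i, p j)) \<partial>W \<partial>W)
      \<le> (\<integral>\<^sup>+x. F x \<partial>\<alpha>) + (\<integral>\<^sup>+x. \<integral>\<^sup>+y. H (x, y) \<partial>\<alpha> \<partial>\<alpha>)"
    "\<And>j. emeasure W {j} \<le> 1 / of_nat n"
    "\<And>A. emeasure W {j. fst (p j) \<in> A} \<le> emeasure (distr \<alpha> borel fst) (\<Union>a\<in>A. ball a \<delta>)"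
proof -
  interpret \<alpha>: prob_space \<alpha> using \<alpha> by (rule borel_probs_prob_space)
  note \<alpha>_sets [measurable_cong] = borel_probs_sets[OF \<alpha>]
  have \<alpha>_space [simp]: "space \<alpha> = UNIV" by (rule borel_probs_space[OF \<alpha>])
  have [measurable]: "(fst :: 'a \<times> 't \<Rightarrow> 'a) \<in> borel_measurable borel"
    unfolding borel_prod[symmetric] by measurable
  obtain \<kappa> :: "'a \<Rightarrow> nat" where [measurable]: "\<kappa> \<in> measurable borel (count_space UNIV)"
    and \<kappa>: "\<And>x y. \<kappa> x = \<kappa> y \<Longrightarrow> dist x y < \<delta>"
    using countable_borel_partition[OF \<open>0 < \<delta>\<close>] by metis
  define cell where "cell i = {x \<in> space \<alpha>. \<kappa> (fst x) = i}" for i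
  have cell [measurable]: "cell i \<in> sets \<alpha>" for i
    unfolding cell_def by measurable
  define m where "m i = emeasure \<alpha> (cell i)" for i
  \<comment> \<open>A null cell carries weight \<open>0\<close>, so any probability measure may serve as its conditional law.\<close>
  define M where "M j = (if m (j div n) = 0 then \<alpha> else uniform_measure \<alpha> (cell (j div n)))" for j
  define w where "w j = m (j div n) / of_nat n" for j
  have M: "prob_space (M j)" for j
    unfolding M_def m_def by (auto intro!: \<alpha>.prob_space_axioms prob_space_uniform_measure)
  have M_sets: "sets (M j) = sets \<alpha>" for j
    by (simp add: M_def)
  have mix: "(\<Sum>j. w j * (\<integral>\<^sup>+x. f x \<partial>M j)) = (\<integral>\<^sup>+x. f x \<partial>\<alpha>)"
    if f [measurable]: "f \<in> borel_measurable \<alpha>" for f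
  proof -
    have "w j * (\<integral>\<^sup>+x. f x \<partial>M j) = (\<integral>\<^sup>+x. f x * indicator (cell (j div n)) x \<partial>\<alpha>) / of_nat n" for j
    proof (cases "m (j div n) = 0")
      case True
      then have "AE x in \<alpha>. x \<notin> cell (j div n)"
        by (intro AE_not_in) (auto simp: m_def null_sets_def)
      then have "(\<integral>\<^sup>+x. f x * indicator (cell (j div n)) x \<partial>\<alpha>) = 0"
        by (subst nn_integral_0_iff_AE) (auto elim!: eventually_mono)
      then show ?thesis using True by (simp add: w_def)
    next
      case False
      let ?I = "\<integral>\<^sup>+x. f x * indicator (cell (j div n)) x \<partial>\<alpha>"
      have "(\<integral>\<^sup>+x. f x \<partial>M j) = ?I / m (j div n)"
        using False by (simp add: M_def nn_integral_uniform_measure m_def)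
      then have "w j * (\<integral>\<^sup>+x. f x \<partial>M j) = (m (j div n) * (?I / m (j div n))) / of_nat n"
        by (simp add: w_def divide_ennreal_def ac_simps)
      also have "m (j div n) * (?I / m (j div n)) = ?I * m (j div n) / m (j div n)"
        by (simp add: ennreal_times_divide mult.commute)
      also have "\<dots> = ?I"
        using False by (intro ennreal_mult_divide_eq) (simp_all add: m_def)
      finally show ?thesis .
    qed
    then have "(\<Sum>j. w j * (\<integral>\<^sup>+x. f x \<partial>M j)) = (\<Sum>i. \<integral>\<^sup>+x. f x * indicator (cell i) x \<partial>\<alpha>)"
      using suminf_repeat[OF \<open>0 < n\<close>, of "\<lambda>i. \<integral>\<^sup>+x. f x * indicator (cell i) x \<partial>\<alpha>"] by simp
    also have "\<dots> = (\<integral>\<^sup>+x. (\<Sum>i. f x * indicator (cell i) x) \<partial>\<alpha>)"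
      by (subst nn_integral_suminf) auto
    also have "\<dots> = (\<integral>\<^sup>+x. f x \<partial>\<alpha>)"
    proof (rule nn_integral_cong)
      fix x
      show "(\<Sum>i. f x * indicator (cell i) x) = f x"
        by (subst suminf_finite[of "{\<kappa> (fst x)}"]) (auto simp: cell_def indicator_def)
    qed
    finally show ?thesis .
  qed
  define W where "W = density (count_space UNIV) w"
  have W_sets: "sets W = UNIV" by (simp add: W_def)
  have W: "(\<integral>\<^sup>+i. f i \<partial>W) = (\<Sum>i. w i * f i)" for f
    unfolding W_def by (simp add: nn_integral_density nn_integral_count_space_nat)
  have "(\<integral>\<^sup>+i. 1 \<partial>W) = 1"
    unfolding W using mix[of "\<lambda>_. 1"] prob_space.emeasure_space_1[OF M] \<alpha>.emeasure_space_1 by simp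
  then have W_prob: "prob_space W"
    by (intro prob_spaceI) simp
  have in_cell: "AE x in M j. w j \<noteq> 0 \<longrightarrow> \<kappa> (fst x) = j div n" for j
  proof (cases "m (j div n) = 0")
    case False
    then show ?thesis
      unfolding M_def by (auto intro!: AE_uniform_measureI simp: cell_def)
  qed (simp add: w_def)
  have F': "F \<in> borel_measurable \<alpha>" and H': "H \<in> borel_measurable (\<alpha> \<Otimes>\<^sub>M \<alpha>)"
    using F H \<alpha>_sets by (auto cong: measurable_cong_sets sets_pair_measure_cong)
  obtain p where p: "\<And>j. w j \<noteq> 0 \<longrightarrow> \<kappa> (fst (p j)) = j div n"
    and bound: "(\<Sum>i. w i * F (p i)) + (\<Sum>i. w i * (\<Sum>j. w j * (if i = j then 0 else H (p i, p j))))
      \<le> (\<integral>\<^sup>+x. F x \<partial>\<alpha>) + (\<integral>\<^sup>+x. \<integral>\<^sup>+y. H (x, y) \<partial>\<alpha> \<partial>\<alpha>)"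
    using sampling_from_mixture[OF M M_sets \<alpha>.prob_space_axioms mix F' H' in_cell] by blast
  show thesis
  proof (rule that[OF W_prob W_sets, of p])
    show "(\<integral>\<^sup>+i. F (p i) \<partial>W) + (\<integral>\<^sup>+i. \<integral>\<^sup>+j. (if i = j then 0 else H (p i, p j)) \<partial>W \<partial>W)
      \<le> (\<integral>\<^sup>+x. F x \<partial>\<alpha>) + (\<integral>\<^sup>+x. \<integral>\<^sup>+y. H (x, y) \<partial>\<alpha> \<partial>\<alpha>)"
      unfolding W by (rule bound)
    show "emeasure W {j} \<le> 1 / of_nat n" for j
    proof -
      have "emeasure W {j} = w j"
        unfolding W_def by (subst emeasure_density) (auto simp: nn_integral_count_space_indicator[symmetric] 
            one_ennreal_def[symmetric] nn_integral_count_space_finite)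
      also have "\<dots> \<le> 1 / of_nat n"
        unfolding w_def m_def by (intro divide_right_mono_ennreal \<alpha>.emeasure_le_1)
      finally show ?thesis .
    qed
    fix A :: "'a set"
    define B where "B = (\<Union>a\<in>A. ball a \<delta>)"
    have B [measurable]: "B \<in> sets borel"
      unfolding B_def by (intro borel_open open_UN) auto
    have "emeasure W {j. fst (p j) \<in> A} = (\<integral>\<^sup>+j. indicator {j. fst (p j) \<in> A} j \<partial>W)"
      by (simp add: W_sets)
    also have "\<dots> = (\<Sum>j. w j * indicator {j. fst (p j) \<in> A} j)"
      by (rule W)
    also have "\<dots> \<le> (\<Sum>j. w j * (\<integral>\<^sup>+x. indicator B (fst x) \<partial>M j))"
    proof (intro suminf_le summableI)
      fix j
      show "w j * indicator {j. fst (p j) \<in> A} j \<le> w j * (\<integral>\<^sup>+x. indicator B (fst x) \<partial>M j)"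
      proof (cases "w j \<noteq> 0 \<and> fst (p j) \<in> A")
        case True
        have "AE x in M j. indicator B (fst x) = (1::ennreal)"
          using in_cell[of j]
        proof eventually_elim
          case (elim x)
          then have "dist (fst (p j)) (fst x) < \<delta>"
            using True p[of j] by (intro \<kappa>) simp
          then have "fst x \<in> B" using True by (auto simp: B_def)
          then show ?case by simp
        qed
        then have "(\<integral>\<^sup>+x. indicator B (fst x) \<partial>M j) = (\<integral>\<^sup>+x. 1 \<partial>M j)"
          by (rule nn_integral_cong_AE)
        then show ?thesis
          using prob_space.emeasure_space_1[OF M] True by simp
      qed auto
    qed
    also have "\<dots> = (\<integral>\<^sup>+x. indicator B (fst x) \<partial>\<alpha>)"
      by (rule mix) measurable
    also have "\<dots> = (\<integral>\<^sup>+x. indicator B x \<partial>distr \<alpha> borel fst)"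
      by (subst nn_integral_distr) auto
    also have "\<dots> = emeasure (distr \<alpha> borel fst) B"
      by simp
    finally show "emeasure W {j. fst (p j) \<in> A} \<le> emeasure (distr \<alpha> borel fst) (\<Union>a\<in>A. ball a \<delta>)"
      by (simp only: B_def)
  qed
qed

section \<open>Limits of discrete competitors\<close>

lemma nn_integral_lsc_le_liminf:
  fixes f :: "'a::second_countable_topology \<Rightarrow> ennreal"
  assumes f: "lower_semicontinuous f"
    and X [measurable]: "\<And>n. X n \<in> borel_measurable M"
    and lim: "AE \<omega> in M. (\<lambda>n. X n \<omega>) \<longlonglongrightarrow> X\<^sub>0 \<omega>"
  shows "(\<integral>\<^sup>+\<omega>. f (X\<^sub>0 \<omega>) \<partial>M) \<le> liminf (\<lambda>n. \<integral>\<^sup>+\<omega>. f (X n \<omega>) \<partial>M)"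
proof -
  have [measurable]: "f \<in> borel_measurable borel"
    using f by (rule lower_semicontinuous_borel_measurable)
  have "(\<integral>\<^sup>+\<omega>. f (X\<^sub>0 \<omega>) \<partial>M) \<le> (\<integral>\<^sup>+\<omega>. liminf (\<lambda>n. f (X n \<omega>)) \<partial>M)"
    using lim by (intro nn_integral_mono_AE)
      (auto elim!: eventually_mono intro: lower_semicontinuous_le_liminf[OF f])
  also have "\<dots> \<le> liminf (\<lambda>n. \<integral>\<^sup>+\<omega>. f (X n \<omega>) \<partial>M)"
    by (rule nn_integral_liminf) measurable
  finally show ?thesis .
qed

lemma ennreal_SUP_min_of_nat: "(SUP k. min x (of_nat k)) = (x::ennreal)"
proof -
  have "(SUP k. inf x (of_nat k)) = inf x (SUP k. of_nat k :: ennreal)"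
    by (rule inf_SUP[symmetric])
  then show ?thesis by (simp add: inf_min ennreal_SUP_of_nat_eq_top)
qed

lemma single_law_tight:
  fixes \<mu> :: "'a::{metric_space, second_countable_topology} measure"
  assumes \<mu>: "\<mu> \<in> borel_probs" and "0 < \<epsilon>" "0 < \<delta>"
  obtains F where "finite F" "measure \<mu> (- (\<Union>q\<in>F. ball q \<delta>)) \<le> \<epsilon>"
proof -
  interpret prob_space \<mu> using \<mu> by (rule borel_probs_prob_space)
  obtain q :: "nat \<Rightarrow> 'a" where q: "\<And>x e. 0 < e \<Longrightarrow> \<exists>i. dist x (q i) < e"
    by (rule countable_dense_sequence) blast
  define B where "B n = - (\<Union>x\<in>q ` {..<n}. ball x \<delta>)" for n
  have "(\<Inter>n. B n) = {}"
  proof (rule equals0I)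
    fix x assume x: "x \<in> (\<Inter>n. B n)"
    obtain i where "dist x (q i) < \<delta>" using q[OF \<open>0 < \<delta>\<close>] by blast
    moreover have "x \<in> B (Suc i)" using x by blast
    ultimately show False by (auto simp: B_def dist_commute)
  qed
  moreover have "decseq B"
    unfolding decseq_def B_def by (intro allI impI compl_mono UN_mono image_mono) auto
  moreover have "B n \<in> sets \<mu>" for n
    unfolding B_def borel_probs_sets[OF \<mu>] by (intro borel_comp borel_open open_UN) auto
  ultimately have "(\<lambda>n. measure \<mu> (B n)) \<longlonglongrightarrow> measure \<mu> {}"
    using finite_Lim_measure_decseq[of B] by auto
  then have "\<forall>\<^sub>F n in sequentially. measure \<mu> (B n) < \<epsilon>"
    using \<open>0 < \<epsilon>\<close> by (intro order_tendstoD) auto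
  then obtain n where "measure \<mu> (B n) < \<epsilon>"
    by (auto simp: eventually_sequentially)
  then show thesis
    by (intro that[of "q ` {..<n}"]) (auto simp: B_def)
qed

text \<open>
  Tightness: the first marginals are close to the single law \<open>\<mu>\<close>, the second ones are controlled by
  Markov's inequality for \<open>L\<close>. The Skorohod representation then lets \<open>c\<close>, \<open>L\<close> and the truncations of \<open>H\<close>
  pass to the limit by Fatou's lemma; for \<open>H\<close> it is applied twice, once per integration. Truncating \<open>H\<close> at level \<open>m\<close> turns the bound
  without the diagonal into a bound with it, at the price of \<open>m\<close> times the largest atom.
\<close>

lemma limit_of_discrete_competitors:
  fixes c :: "'a::polish_space \<times> 'b::polish_space \<Rightarrow> ennreal"
    and L :: "'b \<Rightarrow> ennreal" and H :: "'b \<times> 'b \<Rightarrow> ennreal"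
  assumes c: "lower_semicontinuous c" and L: "lower_semicontinuous L" and H: "lower_semicontinuous H"
    and compact: "\<And>\<kappa>::real. 0 < \<kappa> \<Longrightarrow> compact {y. L y \<le> ennreal \<kappa>}"
    and \<mu>: "\<mu> \<in> borel_probs" and "K < \<top>"
    and W_prob: "\<And>n. prob_space (W n :: nat measure)" and W_sets: "\<And>n. sets (W n) = UNIV"
    and bound: "\<And>n. (\<integral>\<^sup>+i. c (Z n i) \<partial>W n) + (\<integral>\<^sup>+i. L (snd (Z n i)) \<partial>W n)
      + (\<integral>\<^sup>+i. \<integral>\<^sup>+j. (if i = j then 0 else H (snd (Z n i), snd (Z n j))) \<partial>W n \<partial>W n) \<le> K"
    and atoms: "\<And>n j. emeasure (W n) {j} \<le> 1 / of_nat (Suc n)"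
    and close: "\<And>n A. emeasure (W n) {j. fst (Z n j) \<in> A}
      \<le> emeasure \<mu> (\<Union>a\<in>A. ball a (1 / real (Suc n)))"
  shows "\<exists>\<gamma>\<in>probs_with_fst_marginal \<mu>. total_cost c L H \<gamma> \<le> K"
proof -
  have [measurable]: "c \<in> borel_measurable borel" "L \<in> borel_measurable borel" "H \<in> borel_measurable borel"
    using c L H by (auto intro: lower_semicontinuous_borel_measurable)
  interpret \<mu>: prob_space \<mu> using \<mu> by (rule borel_probs_prob_space)
  interpret W: prob_space "W n" for n by (rule W_prob)
  have W_space [simp]: "space (W n) = UNIV" for n
    using sets_eq_imp_space_eq[of "W n" "count_space UNIV"] by (simp add: W_sets)
  have W_measurable [measurable]: "f \<in> measurable (W n) borel" for n and f :: "nat \<Rightarrow> 'z::topological_space"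
    by (simp add: measurable_def W_sets)
  have pair_borel: "(borel :: ('a \<times> 'b) measure) = borel \<Otimes>\<^sub>M borel"
    "(borel :: ('b \<times> 'b) measure) = borel \<Otimes>\<^sub>M borel"
    by (simp_all add: borel_prod)
  have fst_borel [measurable]: "(fst :: 'a \<times> 'b \<Rightarrow> 'a) \<in> borel_measurable borel"
    and snd_borel [measurable]: "(snd :: 'a \<times> 'b \<Rightarrow> 'b) \<in> borel_measurable borel"
    unfolding pair_borel by measurable
  have H_pair [measurable]: "H \<in> borel_measurable (borel \<Otimes>\<^sub>M borel)"
    unfolding borel_prod by measurable
  define M where "M n = distr (W n) borel (Z n)" for n
  have M: "M n \<in> borel_probs" for n
    unfolding M_def by (rule borel_probs_distr[OF W_prob W_measurable])
  have M_sets [measurable_cong]: "sets (M n) = sets borel" for n by (rule borel_probs_sets[OF M])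
  interpret M: prob_space "M n" for n using M by (rule borel_probs_prob_space)
  have M_integral: "(\<integral>\<^sup>+z. f z \<partial>M n) = (\<integral>\<^sup>+i. f (Z n i) \<partial>W n)"
    if "f \<in> borel_measurable borel" for f n
    unfolding M_def using that by (intro nn_integral_distr) auto
  have M_emeasure: "emeasure (M n) B = emeasure (W n) {j. Z n j \<in> B}" if "B \<in> sets borel" for B n
    unfolding M_def using that by (subst emeasure_distr) (auto simp: vimage_def)
  obtain k where K: "K = ennreal k" "0 \<le> k"
    using \<open>K < \<top>\<close> by (cases K) auto
  have tight: "\<exists>F. finite F \<and> (\<forall>\<^sub>F n in sequentially. measure (M n) (- (\<Union>q\<in>F. ball q \<delta>)) \<le> \<epsilon>)"
    if pos: "0 < \<epsilon>" "0 < \<delta>" for \<epsilon> \<delta> :: real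
  proof -
    have half: "0 < \<epsilon> / 2" "0 < \<delta> / 4" using pos by simp_all
    obtain F\<^sub>1 where F\<^sub>1: "finite F\<^sub>1" "measure \<mu> (- (\<Union>q\<in>F\<^sub>1. ball q (\<delta> / 4))) \<le> \<epsilon> / 2"
      by (rule single_law_tight[OF \<mu> half])
    \<comment> \<open>Chosen so that \<open>k / \<kappa> \<le> \<epsilon> / 2\<close> in Markov's inequality; adding \<open>1\<close> keeps \<open>\<kappa>\<close> positive.\<close>
    define \<kappa> where "\<kappa> = 2 * (k + 1) / \<epsilon>"
    have "0 < \<kappa>" using pos K by (simp add: \<kappa>_def)
    obtain F\<^sub>2 where F\<^sub>2: "finite F\<^sub>2" "{y. L y \<le> ennreal \<kappa>} \<subseteq> (\<Union>q\<in>F\<^sub>2. ball q (\<delta> / 2))"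
      using compact[OF \<open>0 < \<kappa>\<close>] pos unfolding compact_eq_totally_bounded
      by (meson half_gt_zero)
    define A where "A = - (\<Union>q\<in>F\<^sub>1. ball q (\<delta> / 2))"
    have in_balls: "z \<in> (\<Union>q\<in>F\<^sub>1 \<times> F\<^sub>2. ball q \<delta>)" if z: "fst z \<notin> A" "L (snd z) \<le> ennreal \<kappa>" for z
    proof -
      obtain q\<^sub>1 where q\<^sub>1: "q\<^sub>1 \<in> F\<^sub>1" "dist q\<^sub>1 (fst z) < \<delta> / 2" using z(1) by (auto simp: A_def)
      obtain q\<^sub>2 where q\<^sub>2: "q\<^sub>2 \<in> F\<^sub>2" "dist q\<^sub>2 (snd z) < \<delta> / 2" using z(2) F\<^sub>2(2) by auto
      have "dist (q\<^sub>1, q\<^sub>2) z \<le> dist q\<^sub>1 (fst z) + dist q\<^sub>2 (snd z)"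
        by (cases z) (simp add: dist_Pair_Pair sqrt_sum_squares_le_sum)
      then show ?thesis using q\<^sub>1 q\<^sub>2 by (intro UN_I[of "(q\<^sub>1, q\<^sub>2)"]) auto
    qed
    obtain N where N: "1 / real (Suc N) < \<delta> / 4"
      using reals_Archimedean[OF half(2)] by (auto simp: inverse_eq_divide)
    have "measure (M n) (- (\<Union>q\<in>F\<^sub>1 \<times> F\<^sub>2. ball q \<delta>)) \<le> \<epsilon>" if "N \<le> n" for n
    proof -
      have "1 / real (Suc n) \<le> 1 / real (Suc N)" using that by (intro divide_left_mono) auto
      then have n: "1 / real (Suc n) \<le> \<delta> / 4" using N by linarith
      have "emeasure (W n) {j. fst (Z n j) \<in> A} \<le> emeasure \<mu> (\<Union>a\<in>A. ball a (1 / real (Suc n)))"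
        by (rule close)
      also have "\<dots> \<le> emeasure \<mu> (- (\<Union>q\<in>F\<^sub>1. ball q (\<delta> / 4)))"
      proof (rule emeasure_mono)
        show "(\<Union>a\<in>A. ball a (1 / real (Suc n))) \<subseteq> - (\<Union>q\<in>F\<^sub>1. ball q (\<delta> / 4))"
        proof safe
          fix x a q assume *: "a \<in> A" "x \<in> ball a (1 / real (Suc n))" "q \<in> F\<^sub>1" "x \<in> ball q (\<delta> / 4)"
          then have "dist q a < \<delta> / 2"
            using dist_triangle2[of q a x] n by simp
          with * show False by (auto simp: A_def)
        qed
        show "- (\<Union>q\<in>F\<^sub>1. ball q (\<delta> / 4)) \<in> sets \<mu>"
          unfolding borel_probs_sets[OF \<mu>] by (intro borel_comp borel_open open_UN) auto
      qed
      finally have 1: "measure (W n) {j. fst (Z n j) \<in> A} \<le> \<epsilon> / 2"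
        using F\<^sub>1(2) by (simp add: W.emeasure_eq_measure \<mu>.emeasure_eq_measure)
      have "ennreal \<kappa> * emeasure (W n) {j. ennreal \<kappa> < L (snd (Z n j))}
          = (\<integral>\<^sup>+j. ennreal \<kappa> * indicator {j. ennreal \<kappa> < L (snd (Z n j))} j \<partial>W n)"
        by (subst nn_integral_cmult_indicator) (auto simp: W_sets)
      also have "\<dots> \<le> (\<integral>\<^sup>+j. L (snd (Z n j)) \<partial>W n)"
        by (intro nn_integral_mono) (auto split: split_indicator)
      also have "\<dots> \<le> K"
        using bound[of n] by (meson add_increasing add_increasing2 order.trans zero_le order_refl)
      finally have "\<kappa> * measure (W n) {j. ennreal \<kappa> < L (snd (Z n j))} \<le> k"
        using \<open>0 < \<kappa>\<close> K by (simp add: W.emeasure_eq_measure flip: ennreal_mult)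
      then have "measure (W n) {j. ennreal \<kappa> < L (snd (Z n j))} \<le> k / \<kappa>"
        using \<open>0 < \<kappa>\<close> by (simp add: pos_le_divide_eq mult.commute)
      also have "\<dots> \<le> \<epsilon> / 2"
        using \<open>0 < \<epsilon>\<close> K by (simp add: \<kappa>_def field_simps)
      finally have 2: "measure (W n) {j. ennreal \<kappa> < L (snd (Z n j))} \<le> \<epsilon> / 2" .
      have V: "- (\<Union>q\<in>F\<^sub>1 \<times> F\<^sub>2. ball q \<delta>) \<in> sets borel"
        by (intro borel_comp borel_open open_UN) auto
      have "measure (M n) (- (\<Union>q\<in>F\<^sub>1 \<times> F\<^sub>2. ball q \<delta>)) = measure (W n) {j. Z n j \<in> - (\<Union>q\<in>F\<^sub>1 \<times> F\<^sub>2. ball q \<delta>)}"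
        unfolding measure_def M_emeasure[OF V] ..
      also have "\<dots> \<le> measure (W n) ({j. fst (Z n j) \<in> A} \<union> {j. ennreal \<kappa> < L (snd (Z n j))})"
      proof (rule W.finite_measure_mono)
        show "{j. Z n j \<in> - (\<Union>q\<in>F\<^sub>1 \<times> F\<^sub>2. ball q \<delta>)}
            \<subseteq> {j. fst (Z n j) \<in> A} \<union> {j. ennreal \<kappa> < L (snd (Z n j))}"
        proof
          fix j assume j: "j \<in> {j. Z n j \<in> - (\<Union>q\<in>F\<^sub>1 \<times> F\<^sub>2. ball q \<delta>)}"
          show "j \<in> {j. fst (Z n j) \<in> A} \<union> {j. ennreal \<kappa> < L (snd (Z n j))}"
          proof (rule ccontr)
            assume "\<not> ?thesis"
            then have "fst (Z n j) \<notin> A" "L (snd (Z n j)) \<le> ennreal \<kappa>"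
              by (simp_all add: not_less)
            from in_balls[OF this] j show False by blast
          qed
        qed
      qed (simp add: W_sets)
      also have "\<dots> \<le> measure (W n) {j. fst (Z n j) \<in> A} + measure (W n) {j. ennreal \<kappa> < L (snd (Z n j))}"
        by (intro measure_Un_le) (auto simp: W_sets)
      also have "\<dots> \<le> \<epsilon>" using 1 2 by simp
      finally show ?thesis .
    qed
    then show ?thesis
      using F\<^sub>1(1) F\<^sub>2(1) by (intro exI[of _ "F\<^sub>1 \<times> F\<^sub>2"]) (auto simp: eventually_sequentially)
  qed
  obtain r :: "nat \<Rightarrow> nat" and \<Omega> :: "real measure" and X X\<^sub>0 where r: "strict_mono r"
    and \<Omega>: "prob_space \<Omega>" and X [measurable]: "\<And>n. X n \<in> borel_measurable \<Omega>"
    and distr_X: "\<And>n. distr \<Omega> borel (X n) = M (r n)"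
    and X\<^sub>0 [measurable]: "X\<^sub>0 \<in> borel_measurable \<Omega>" and lim: "AE \<omega> in \<Omega>. (\<lambda>n. X n \<omega>) \<longlonglongrightarrow> X\<^sub>0 \<omega>"
    by (rule skorohod_subsequence[OF M tight]) (assumption+, rule that)
  interpret \<Omega>: prob_space \<Omega> by (rule \<Omega>)
  have X_integral: "(\<integral>\<^sup>+\<omega>. f (X n \<omega>) \<partial>\<Omega>) = (\<integral>\<^sup>+i. f (Z (r n) i) \<partial>W (r n))"
    if [measurable]: "f \<in> borel_measurable borel" for f n
  proof -
    have "(\<integral>\<^sup>+\<omega>. f (X n \<omega>) \<partial>\<Omega>) = (\<integral>\<^sup>+z. f z \<partial>distr \<Omega> borel (X n))"
      by (subst nn_integral_distr) auto
    then show ?thesis by (simp add: distr_X M_integral)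
  qed
  have r_lim: "(\<lambda>n. 1 / real (Suc (r n))) \<longlonglongrightarrow> 0"
    using LIMSEQ_subseq_LIMSEQ[OF LIMSEQ_inverse_real_of_nat r] by (simp add: comp_def inverse_eq_divide)
  define \<gamma> where "\<gamma> = distr \<Omega> borel X\<^sub>0"
  have \<gamma>: "\<gamma> \<in> borel_probs"
    unfolding \<gamma>_def by (rule borel_probs_distr[OF \<Omega> X\<^sub>0])
  have lim_fst: "AE \<omega> in \<Omega>. (\<lambda>n. fst (X n \<omega>)) \<longlonglongrightarrow> fst (X\<^sub>0 \<omega>)"
    using lim by eventually_elim (rule tendsto_fst)
  have lim_snd: "AE \<omega> in \<Omega>. (\<lambda>n. snd (X n \<omega>)) \<longlonglongrightarrow> snd (X\<^sub>0 \<omega>)"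
    using lim by eventually_elim (rule tendsto_snd)
  have "distr \<gamma> borel fst = \<mu>"
  proof (rule borel_probs_eqI)
    show "distr \<gamma> borel fst \<in> borel_probs"
      using \<gamma> fst_borel borel_probs_sets[OF \<gamma>]
      by (intro borel_probs_distr borel_probs_prob_space) (auto cong: measurable_cong_sets)
    fix G :: "'a set" and \<delta> :: real assume G: "open G" and "0 < \<delta>"
    have [measurable]: "G \<in> sets borel" using G by simp
    \<comment> \<open>The portmanteau inequality for open sets is Fatou's lemma for their indicators.\<close>
    have lsc: "lower_semicontinuous (indicator G :: 'a \<Rightarrow> ennreal)"
      unfolding lower_semicontinuous_def le_Liminf_iff
    proof safe
      fix x and y :: ennreal assume "y < indicator G x"
      then have "x \<in> G" "y < 1" by (auto split: split_indicator_asm)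
      then have "\<forall>\<^sub>F z in at x. z \<in> G"
        using G by (auto simp: eventually_at_topological)
      then show "\<forall>\<^sub>F z in at x. y < indicator G z"
        by eventually_elim (use \<open>y < 1\<close> in simp)
    qed
    have "emeasure (distr \<gamma> borel fst) G = (\<integral>\<^sup>+\<omega>. indicator G (fst (X\<^sub>0 \<omega>)) \<partial>\<Omega>)"
      unfolding \<gamma>_def by (subst distr_distr) (auto simp: comp_def nn_integral_distr simp flip: nn_integral_indicator)
    also have "\<dots> \<le> liminf (\<lambda>n. \<integral>\<^sup>+\<omega>. indicator G (fst (X n \<omega>)) \<partial>\<Omega>)"
      by (rule nn_integral_lsc_le_liminf[OF lsc _ lim_fst]) measurable
    also have "\<dots> \<le> emeasure \<mu> (\<Union>x\<in>G. ball x \<delta>)"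
    proof (rule order.trans[OF Liminf_le_Limsup Limsup_bounded])
      have "\<forall>\<^sub>F n in sequentially. 1 / real (Suc (r n)) < \<delta>"
        using r_lim \<open>0 < \<delta>\<close> by (rule order_tendstoD)
      then show "\<forall>\<^sub>F n in sequentially. (\<integral>\<^sup>+\<omega>. indicator G (fst (X n \<omega>)) \<partial>\<Omega>) \<le> emeasure \<mu> (\<Union>x\<in>G. ball x \<delta>)"
      proof eventually_elim
        case (elim n)
        have "(\<integral>\<^sup>+\<omega>. indicator G (fst (X n \<omega>)) \<partial>\<Omega>) = (\<integral>\<^sup>+i. indicator G (fst (Z (r n) i)) \<partial>W (r n))"
          by (rule X_integral) measurable
        also have "\<dots> = (\<integral>\<^sup>+i. indicator {j. fst (Z (r n) j) \<in> G} i \<partial>W (r n))"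
          by (intro nn_integral_cong) (simp split: split_indicator)
        also have "\<dots> = emeasure (W (r n)) {j. fst (Z (r n) j) \<in> G}"
          by (simp add: W_sets)
        also have "\<dots> \<le> emeasure \<mu> (\<Union>x\<in>G. ball x (1 / real (Suc (r n))))"
          by (rule close)
        also have "\<dots> \<le> emeasure \<mu> (\<Union>x\<in>G. ball x \<delta>)"
          using elim by (intro emeasure_mono UN_mono subset_ball)
            (auto simp: borel_probs_sets[OF \<mu>] intro!: borel_open)
        finally show ?case .
      qed
    qed simp
    finally show "emeasure (distr \<gamma> borel fst) G \<le> emeasure \<mu> (\<Union>x\<in>G. ball x \<delta>)" .
  qed (rule \<mu>)
  then have \<gamma>_marginal: "\<gamma> \<in> probs_with_fst_marginal \<mu>"
    using \<gamma> by (simp add: probs_with_fst_marginal_def)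
  define h where "h m w = min (H w) (of_nat m)" for m :: nat and w
  have h_lsc: "lower_semicontinuous (h m)" for m
    unfolding h_def by (rule lower_semicontinuous_min[OF H])
  have h_measurable [measurable]: "h m \<in> borel_measurable (borel \<Otimes>\<^sub>M borel)" for m
    unfolding h_def by measurable
  let ?h = "\<lambda>m. \<integral>\<^sup>+\<omega>. \<integral>\<^sup>+\<omega>'. h m (snd (X\<^sub>0 \<omega>), snd (X\<^sub>0 \<omega>')) \<partial>\<Omega> \<partial>\<Omega>"
  let ?c = "\<integral>\<^sup>+\<omega>. c (X\<^sub>0 \<omega>) \<partial>\<Omega>" and ?L = "\<integral>\<^sup>+\<omega>. L (snd (X\<^sub>0 \<omega>)) \<partial>\<Omega>"
  have truncated: "?c + ?L + ?h m \<le> K" for m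
  proof -
    define a where "a n = (\<integral>\<^sup>+\<omega>. c (X n \<omega>) \<partial>\<Omega>)" for n
    define b where "b n = (\<integral>\<^sup>+\<omega>. L (snd (X n \<omega>)) \<partial>\<Omega>)" for n
    define d where "d n = (\<integral>\<^sup>+\<omega>. \<integral>\<^sup>+\<omega>'. h m (snd (X n \<omega>), snd (X n \<omega>')) \<partial>\<Omega> \<partial>\<Omega>)" for n
    have "?c \<le> liminf a"
      unfolding a_def by (rule nn_integral_lsc_le_liminf[OF c X lim])
    moreover have "?L \<le> liminf b"
      unfolding b_def by (rule nn_integral_lsc_le_liminf[OF L _ lim_snd]) measurable
    moreover have "?h m \<le> liminf d"
    proof -
      have "?h m \<le> (\<integral>\<^sup>+\<omega>. liminf (\<lambda>n. \<integral>\<^sup>+\<omega>'. h m (snd (X n \<omega>), snd (X n \<omega>')) \<partial>\<Omega>) \<partial>\<Omega>)"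
      proof (rule nn_integral_mono_AE)
        show "AE \<omega> in \<Omega>. (\<integral>\<^sup>+\<omega>'. h m (snd (X\<^sub>0 \<omega>), snd (X\<^sub>0 \<omega>')) \<partial>\<Omega>)
            \<le> liminf (\<lambda>n. \<integral>\<^sup>+\<omega>'. h m (snd (X n \<omega>), snd (X n \<omega>')) \<partial>\<Omega>)"
          using lim_snd
        proof eventually_elim
          case (elim \<omega>)
          show ?case
          proof (rule nn_integral_lsc_le_liminf[OF h_lsc])
            show "(\<lambda>\<omega>'. (snd (X n \<omega>), snd (X n \<omega>'))) \<in> borel_measurable \<Omega>" for n
              unfolding pair_borel by measurable
            show "AE \<omega>' in \<Omega>. (\<lambda>n. (snd (X n \<omega>), snd (X n \<omega>'))) \<longlonglongrightarrow> (snd (X\<^sub>0 \<omega>), snd (X\<^sub>0 \<omega>'))"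
              using lim_snd by eventually_elim (intro tendsto_Pair elim)
          qed
        qed
      qed
      also have "\<dots> \<le> liminf d"
        unfolding d_def by (rule nn_integral_liminf) measurable
      finally show ?thesis .
    qed
    ultimately have "?c + ?L + ?h m \<le> liminf a + liminf b + liminf d"
      by (intro add_mono)
    also have "\<dots> \<le> liminf (\<lambda>n. a n + b n) + liminf d"
      by (intro add_right_mono liminf_add_le_ennreal)
    also have "\<dots> \<le> liminf (\<lambda>n. a n + b n + d n)"
      by (rule liminf_add_le_ennreal)
    also have "\<dots> \<le> liminf (\<lambda>n. K + ennreal (real m * (1 / real (Suc (r n)))))"
    proof (intro Liminf_mono always_eventually allI)
      fix n
      let ?W = "W (r n)" and ?Z = "Z (r n)"
      let ?H = "\<integral>\<^sup>+i. \<integral>\<^sup>+j. (if i = j then 0 else H (snd (?Z i), snd (?Z j))) \<partial>?W \<partial>?W"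
      have "d n = (\<integral>\<^sup>+\<omega>. \<integral>\<^sup>+j. h m (snd (X n \<omega>), snd (?Z j)) \<partial>?W \<partial>\<Omega>)"
        unfolding d_def by (intro nn_integral_cong X_integral) measurable
      also have "\<dots> = (\<integral>\<^sup>+i. \<integral>\<^sup>+j. h m (snd (?Z i), snd (?Z j)) \<partial>?W \<partial>?W)"
        by (rule X_integral) measurable
      \<comment> \<open>On the diagonal the truncated cost is at most \<open>m\<close>.\<close>
      also have "\<dots> \<le> (\<integral>\<^sup>+i. \<integral>\<^sup>+j. (if i = j then 0 else H (snd (?Z i), snd (?Z j)))
          + of_nat m * indicator {i} j \<partial>?W \<partial>?W)"
        by (intro nn_integral_mono) (auto simp: h_def split: split_indicator)
      also have "\<dots> = ?H + (\<integral>\<^sup>+i. of_nat m * emeasure ?W {i} \<partial>?W)"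
      proof -
        have "(\<integral>\<^sup>+j. (if i = j then 0 else H (snd (?Z i), snd (?Z j))) + of_nat m * indicator {i} j \<partial>?W)
            = (\<integral>\<^sup>+j. (if i = j then 0 else H (snd (?Z i), snd (?Z j))) \<partial>?W) + of_nat m * emeasure ?W {i}" for i
          by (subst nn_integral_add[OF W_measurable W_measurable], subst nn_integral_cmult_indicator)
            (simp_all only: W_sets UNIV_I)
        then show ?thesis
          by (simp only: nn_integral_add[OF W_measurable W_measurable])
      qed
      also have "\<dots> \<le> ?H + (\<integral>\<^sup>+i. of_nat m * (1 / of_nat (Suc (r n))) \<partial>?W)"
        by (intro add_left_mono nn_integral_mono mult_left_mono atoms) simp
      also have "(\<integral>\<^sup>+i. of_nat m * (1 / of_nat (Suc (r n))) \<partial>?W) = ennreal (real m * (1 / real (Suc (r n))))"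
      proof -
        have "1 / of_nat (Suc (r n)) = ennreal (1 / real (Suc (r n)))"
          using divide_ennreal[of 1 "real (Suc (r n))"]
          by (simp add: ennreal_of_nat_eq_real_of_nat del: of_nat_Suc)
        then show ?thesis
          using W.emeasure_space_1[of "r n"]
          by (simp add: ennreal_of_nat_eq_real_of_nat del: of_nat_Suc flip: ennreal_mult)
      qed
      finally have d: "d n \<le> ?H + ennreal (real m * (1 / real (Suc (r n))))" .
      have "a n = (\<integral>\<^sup>+i. c (?Z i) \<partial>?W)"
        unfolding a_def by (rule X_integral) measurable
      moreover have "b n = (\<integral>\<^sup>+i. L (snd (?Z i)) \<partial>?W)"
        unfolding b_def by (rule X_integral) measurable
      ultimately have "a n + b n + d n \<le> (\<integral>\<^sup>+i. c (?Z i) \<partial>?W) + (\<integral>\<^sup>+i. L (snd (?Z i)) \<partial>?W)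
          + (?H + ennreal (real m * (1 / real (Suc (r n)))))"
        using d by (simp add: add_left_mono)
      also have "\<dots> \<le> K + ennreal (real m * (1 / real (Suc (r n))))"
        unfolding add.assoc[symmetric] by (intro add_right_mono bound)
      finally show "a n + b n + d n \<le> K + ennreal (real m * (1 / real (Suc (r n))))" .
    qed
    also have "\<dots> = K"
    proof (rule lim_imp_Liminf)
      have "(\<lambda>n. real m * (1 / real (Suc (r n)))) \<longlonglongrightarrow> real m * 0"
        by (intro tendsto_intros r_lim)
      then have "(\<lambda>n. K + ennreal (real m * (1 / real (Suc (r n))))) \<longlonglongrightarrow> K + ennreal (real m * 0)"
        by (intro tendsto_add tendsto_const tendsto_ennrealI)
      then show "(\<lambda>n. K + ennreal (real m * (1 / real (Suc (r n))))) \<longlonglongrightarrow> K" by simp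
    qed simp
    finally show ?thesis .
  qed
  have h_SUP: "(SUP m. h m w) = H w" for w
    unfolding h_def by (rule ennreal_SUP_min_of_nat)
  have h_mono: "h m w \<le> h m' w" if "m \<le> m'" for m m' w
    unfolding h_def using that by (intro min.mono) auto
  have full: "(\<integral>\<^sup>+\<omega>. \<integral>\<^sup>+\<omega>'. H (snd (X\<^sub>0 \<omega>), snd (X\<^sub>0 \<omega>')) \<partial>\<Omega> \<partial>\<Omega>) = (SUP m. ?h m)"
  proof -
    have inner: "(\<integral>\<^sup>+\<omega>'. H (snd (X\<^sub>0 \<omega>), snd (X\<^sub>0 \<omega>')) \<partial>\<Omega>)
        = (SUP m. \<integral>\<^sup>+\<omega>'. h m (snd (X\<^sub>0 \<omega>), snd (X\<^sub>0 \<omega>')) \<partial>\<Omega>)" for \<omega>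
      unfolding h_SUP[symmetric]
      by (rule nn_integral_monotone_convergence_SUP) (auto simp: incseq_def le_fun_def h_mono)
    show ?thesis
      unfolding inner
      by (rule nn_integral_monotone_convergence_SUP)
        (auto simp: incseq_def le_fun_def h_mono intro!: nn_integral_mono)
  qed
  have "total_cost c L H \<gamma> = ?c + ?L + (\<integral>\<^sup>+\<omega>. \<integral>\<^sup>+\<omega>'. H (snd (X\<^sub>0 \<omega>), snd (X\<^sub>0 \<omega>')) \<partial>\<Omega> \<partial>\<Omega>)"
  proof -
    define \<nu> where "\<nu> = distr \<gamma> borel snd"
    have \<nu>: "\<nu> = distr \<Omega> borel (\<lambda>\<omega>. snd (X\<^sub>0 \<omega>))"
      unfolding \<nu>_def \<gamma>_def by (subst distr_distr) (auto simp: comp_def)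
    interpret \<nu>: prob_space \<nu>
      unfolding \<nu> by (rule \<Omega>.prob_space_distr) measurable
    have [measurable_cong]: "sets \<nu> = sets borel" by (simp add: \<nu>)
    have "(\<integral>\<^sup>+w. H w \<partial>(\<nu> \<Otimes>\<^sub>M \<nu>)) = (\<integral>\<^sup>+y. \<integral>\<^sup>+y'. H (y, y') \<partial>\<nu> \<partial>\<nu>)"
      by (subst \<nu>.nn_integral_fst[symmetric]) auto
    also have "\<dots> = (\<integral>\<^sup>+y. \<integral>\<^sup>+\<omega>'. H (y, snd (X\<^sub>0 \<omega>')) \<partial>\<Omega> \<partial>\<nu>)"
      by (rule nn_integral_cong, subst (1) \<nu>, rule nn_integral_distr) measurable
    also have "\<dots> = (\<integral>\<^sup>+\<omega>. \<integral>\<^sup>+\<omega>'. H (snd (X\<^sub>0 \<omega>), snd (X\<^sub>0 \<omega>')) \<partial>\<Omega> \<partial>\<Omega>)"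
      by (subst (1) \<nu>, rule nn_integral_distr) measurable
    finally have "(\<integral>\<^sup>+w. H w \<partial>(\<nu> \<Otimes>\<^sub>M \<nu>)) = \<dots>" .
    moreover have "(\<integral>\<^sup>+y. L y \<partial>\<nu>) = ?L"
      unfolding \<nu> by (rule nn_integral_distr) measurable
    moreover have "(\<integral>\<^sup>+z. c z \<partial>\<gamma>) = ?c"
      unfolding \<gamma>_def by (rule nn_integral_distr) measurable
    ultimately show ?thesis
      unfolding total_cost_def \<nu>_def[symmetric] Let_def by simp
  qed
  also have "\<dots> = (SUP m. ?c + ?L + ?h m)"
    unfolding full by (rule ennreal_SUP_add_right) simp
  also have "\<dots> \<le> K"
    by (intro SUP_least truncated)
  finally show ?thesis using \<gamma>_marginal by blast
qed

section \<open>Lipschitz dependence of the optimal cost on the marginal\<close>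

text \<open>
  All functions on the discrete index space are measurable, so composing the sampled triples
  with \<open>G\<close> is legitimate there. The points keep their first coordinate \<open>x\<^sub>1\<close>, hence also the control
  on the first marginal.
\<close>

lemma discrete_competitor:
  fixes c :: "'a::polish_space \<times> 'b::polish_space \<Rightarrow> ennreal"
    and L :: "'b \<Rightarrow> ennreal" and H :: "'b \<times> 'b \<Rightarrow> ennreal"
    and \<alpha> :: "('a \<times> 'a \<times> 'b) measure" and C\<^sub>0 :: real
  assumes c [measurable]: "c \<in> borel_measurable borel" and L [measurable]: "L \<in> borel_measurable borel"
    and H [measurable]: "H \<in> borel_measurable borel"
    and "0 < C\<^sub>0"
    and G_c: "\<And>x\<^sub>0 x\<^sub>1 y. c (x\<^sub>1, G x\<^sub>1 x\<^sub>0 y) \<le> c (x\<^sub>0, y) + ennreal (C\<^sub>0 * dist x\<^sub>1 x\<^sub>0)"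
    and G_L: "\<And>x\<^sub>0 x\<^sub>1 y. L (G x\<^sub>1 x\<^sub>0 y) \<le> L y + ennreal (C\<^sub>0 * dist x\<^sub>1 x\<^sub>0)"
    and G_H: "\<And>x\<^sub>0 x\<^sub>1 x\<^sub>0' x\<^sub>1' y y'. H (G x\<^sub>1 x\<^sub>0 y, G x\<^sub>1' x\<^sub>0' y')
      \<le> H (y, y') + ennreal (C\<^sub>0 * (dist x\<^sub>1 x\<^sub>0 + dist x\<^sub>1' x\<^sub>0'))"
    and \<alpha>: "\<alpha> \<in> borel_probs" and "0 < n" "0 < \<delta>"
  obtains W :: "nat measure" and Z :: "nat \<Rightarrow> 'a \<times> 'b" where "prob_space W" "sets W = UNIV"
    "(\<integral>\<^sup>+i. c (Z i) \<partial>W) + (\<integral>\<^sup>+i. L (snd (Z i)) \<partial>W)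
      + (\<integral>\<^sup>+i. \<integral>\<^sup>+j. (if i = j then 0 else H (snd (Z i), snd (Z j))) \<partial>W \<partial>W)
     \<le> total_cost c L H (distr \<alpha> borel snd)
      + ennreal (4 * C\<^sub>0) * (\<integral>\<^sup>+(x\<^sub>1, x\<^sub>0, y). ennreal (dist x\<^sub>1 x\<^sub>0) \<partial>\<alpha>)"
    "\<And>j. emeasure W {j} \<le> 1 / of_nat n"
    "\<And>A. emeasure W {j. fst (Z j) \<in> A} \<le> emeasure (distr \<alpha> borel fst) (\<Union>a\<in>A. ball a \<delta>)"
proof -
  have pair_borel: "(borel :: ('a \<times> 'b) measure) = borel \<Otimes>\<^sub>M borel"
    "(borel :: ('a \<times> 'a \<times> 'b) measure) = borel \<Otimes>\<^sub>M borel"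
    by (simp_all add: borel_prod)
  have [measurable]: "(snd :: 'a \<times> 'a \<times> 'b \<Rightarrow> 'a \<times> 'b) \<in> borel_measurable borel"
    "(fst :: 'a \<times> 'a \<times> 'b \<Rightarrow> 'a) \<in> borel_measurable borel"
    unfolding pair_borel(2) by measurable
  have [measurable]: "(snd :: 'a \<times> 'b \<Rightarrow> 'b) \<in> borel_measurable borel"
    unfolding pair_borel(1) by measurable
  have H_pair [measurable]: "H \<in> borel_measurable (borel \<Otimes>\<^sub>M borel)"
    unfolding borel_prod by measurable
  have dist_measurable [measurable]: "(\<lambda>t::'a \<times> 'a \<times> 'b. dist (fst t) (fst (snd t))) \<in> borel_measurable borel"
    by (intro borel_measurable_continuous_onI continuous_intros)
  interpret \<alpha>: prob_space \<alpha> using \<alpha> by (rule borel_probs_prob_space)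
  have \<alpha>_sets [measurable_cong]: "sets \<alpha> = sets borel" by (rule borel_probs_sets[OF \<alpha>])
  define d where "d t = ennreal (C\<^sub>0 * dist (fst t) (fst (snd t)))" for t :: "'a \<times> 'a \<times> 'b"
  have [measurable]: "d \<in> borel_measurable borel"
    unfolding d_def by measurable
  \<comment> \<open>The four copies of \<open>d\<close> pay for the increase of the costs under \<open>G\<close>: one for \<open>c\<close>, one for \<open>L\<close>
    and two for \<open>H\<close>.\<close>
  define F where "F t = c (snd t) + L (snd (snd t)) + 4 * d t" for t :: "'a \<times> 'a \<times> 'b"
  have F: "F \<in> borel_measurable borel"
    unfolding F_def by measurable
  define H' where "H' w = H (snd (snd (fst w)), snd (snd (snd w)))"
    for w :: "('a \<times> 'a \<times> 'b) \<times> ('a \<times> 'a \<times> 'b)"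
  have H': "H' \<in> borel_measurable (borel \<Otimes>\<^sub>M borel)"
    unfolding H'_def by measurable
  obtain W :: "nat measure" and p :: "nat \<Rightarrow> 'a \<times> 'a \<times> 'b" where W: "prob_space W" and W_sets: "sets W = UNIV"
    and W_bound: "(\<integral>\<^sup>+i. F (p i) \<partial>W) + (\<integral>\<^sup>+i. \<integral>\<^sup>+j. (if i = j then 0 else H' (p i, p j)) \<partial>W \<partial>W)
      \<le> (\<integral>\<^sup>+x. F x \<partial>\<alpha>) + (\<integral>\<^sup>+x. \<integral>\<^sup>+y. H' (x, y) \<partial>\<alpha> \<partial>\<alpha>)"
    and atoms: "\<And>j. emeasure W {j} \<le> 1 / of_nat n"
    and close: "\<And>A. emeasure W {j. fst (p j) \<in> A} \<le> emeasure (distr \<alpha> borel fst) (\<Union>a\<in>A. ball a \<delta>)"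
    by (rule discrete_approximation[OF \<alpha> F H' \<open>0 < n\<close> \<open>0 < \<delta>\<close>]) (rule that)
  interpret W: prob_space W by (rule W)
  have W_space: "space W = UNIV"
    using sets_eq_imp_space_eq[of W "count_space UNIV"] by (simp add: W_sets)
  have Wm: "f \<in> borel_measurable W" for f :: "nat \<Rightarrow> ennreal"
    by (simp add: measurable_def W_sets W_space)
  define Z where "Z i = (fst (p i), G (fst (p i)) (fst (snd (p i))) (snd (snd (p i))))" for i
  let ?D = "\<integral>\<^sup>+i. d (p i) \<partial>W"
  let ?H = "\<integral>\<^sup>+i. \<integral>\<^sup>+j. (if i = j then 0 else H' (p i, p j)) \<partial>W \<partial>W"
  have "(\<integral>\<^sup>+i. c (Z i) \<partial>W) \<le> (\<integral>\<^sup>+i. c (snd (p i)) + d (p i) \<partial>W)"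
  proof (rule nn_integral_mono)
    fix i
    show "c (Z i) \<le> c (snd (p i)) + d (p i)"
      using G_c[of "fst (p i)" "fst (snd (p i))" "snd (snd (p i))"] by (simp add: Z_def d_def)
  qed
  also have "\<dots> = (\<integral>\<^sup>+i. c (snd (p i)) \<partial>W) + ?D"
    by (rule nn_integral_add[OF Wm Wm])
  finally have 1: "(\<integral>\<^sup>+i. c (Z i) \<partial>W) \<le> (\<integral>\<^sup>+i. c (snd (p i)) \<partial>W) + ?D" .
  have "(\<integral>\<^sup>+i. L (snd (Z i)) \<partial>W) \<le> (\<integral>\<^sup>+i. L (snd (snd (p i))) + d (p i) \<partial>W)"
    using G_L by (intro nn_integral_mono) (auto simp: Z_def d_def)
  also have "\<dots> = (\<integral>\<^sup>+i. L (snd (snd (p i))) \<partial>W) + ?D"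
    by (rule nn_integral_add[OF Wm Wm])
  finally have 2: "(\<integral>\<^sup>+i. L (snd (Z i)) \<partial>W) \<le> (\<integral>\<^sup>+i. L (snd (snd (p i))) \<partial>W) + ?D" .
  have "(\<integral>\<^sup>+i. \<integral>\<^sup>+j. (if i = j then 0 else H (snd (Z i), snd (Z j))) \<partial>W \<partial>W)
      \<le> (\<integral>\<^sup>+i. \<integral>\<^sup>+j. (if i = j then 0 else H' (p i, p j)) + (d (p i) + d (p j)) \<partial>W \<partial>W)"
  proof (intro nn_integral_mono)
    fix i j
    have "ennreal (C\<^sub>0 * (dist (fst (p i)) (fst (snd (p i))) + dist (fst (p j)) (fst (snd (p j)))))
        = d (p i) + d (p j)"
      using \<open>0 < C\<^sub>0\<close> by (simp add: d_def distrib_left)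
    then have "H (snd (Z i), snd (Z j)) \<le> H' (p i, p j) + (d (p i) + d (p j))"
      unfolding Z_def H'_def
      using G_H[of "fst (p i)" "fst (snd (p i))" "snd (snd (p i))" "fst (p j)" "fst (snd (p j))" "snd (snd (p j))"]
      by simp
    then show "(if i = j then 0 else H (snd (Z i), snd (Z j)))
        \<le> (if i = j then 0 else H' (p i, p j)) + (d (p i) + d (p j))"
      by simp
  qed
  also have "\<dots> = ?H + (?D + ?D)"
    by (simp only: nn_integral_add[OF Wm Wm] nn_integral_const W.emeasure_space_1 mult_1_right)
  finally have 3: "(\<integral>\<^sup>+i. \<integral>\<^sup>+j. (if i = j then 0 else H (snd (Z i), snd (Z j))) \<partial>W \<partial>W) \<le> ?H + (?D + ?D)" .
  have F_W: "(\<integral>\<^sup>+i. F (p i) \<partial>W)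
      = (\<integral>\<^sup>+i. c (snd (p i)) \<partial>W) + (\<integral>\<^sup>+i. L (snd (snd (p i))) \<partial>W) + 4 * ?D"
    unfolding F_def by (simp only: nn_integral_add[OF Wm Wm] nn_integral_cmult[OF Wm])
  have four: "4 * x = x + x + (x + x)" for x :: ennreal
    by (simp only: mult_2[symmetric] mult.assoc[symmetric]) simp
  have "(\<integral>\<^sup>+i. c (Z i) \<partial>W) + (\<integral>\<^sup>+i. L (snd (Z i)) \<partial>W)
      + (\<integral>\<^sup>+i. \<integral>\<^sup>+j. (if i = j then 0 else H (snd (Z i), snd (Z j))) \<partial>W \<partial>W)
      \<le> ((\<integral>\<^sup>+i. c (snd (p i)) \<partial>W) + ?D) + ((\<integral>\<^sup>+i. L (snd (snd (p i))) \<partial>W) + ?D) + (?H + (?D + ?D))"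
    by (intro add_mono 1 2 3)
  also have "\<dots> = (\<integral>\<^sup>+i. F (p i) \<partial>W) + ?H"
    unfolding F_W four by (simp only: ac_simps)
  also have "\<dots> \<le> (\<integral>\<^sup>+x. F x \<partial>\<alpha>) + (\<integral>\<^sup>+x. \<integral>\<^sup>+y. H' (x, y) \<partial>\<alpha> \<partial>\<alpha>)"
    by (rule W_bound)
  also have "\<dots> = total_cost c L H (distr \<alpha> borel snd)
      + ennreal (4 * C\<^sub>0) * (\<integral>\<^sup>+(x\<^sub>1, x\<^sub>0, y). ennreal (dist x\<^sub>1 x\<^sub>0) \<partial>\<alpha>)"
  proof -
    define \<nu> where "\<nu> = distr (distr \<alpha> borel snd) borel snd"
    have \<nu>: "\<nu> = distr \<alpha> borel (\<lambda>t. snd (snd t))"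
      unfolding \<nu>_def by (subst distr_distr) (auto simp: comp_def)
    interpret \<nu>: prob_space \<nu>
      unfolding \<nu> by (rule \<alpha>.prob_space_distr) measurable
    have [measurable_cong]: "sets \<nu> = sets borel" by (simp add: \<nu>)
    have \<nu>_integral: "(\<integral>\<^sup>+y. f y \<partial>\<nu>) = (\<integral>\<^sup>+t. f (snd (snd t)) \<partial>\<alpha>)"
      if "f \<in> borel_measurable borel" for f
      unfolding \<nu> using that by (intro nn_integral_distr) auto
    have "(\<integral>\<^sup>+w. H w \<partial>(\<nu> \<Otimes>\<^sub>M \<nu>)) = (\<integral>\<^sup>+y. \<integral>\<^sup>+y'. H (y, y') \<partial>\<nu> \<partial>\<nu>)"
      by (subst \<nu>.nn_integral_fst[symmetric]) auto
    also have "\<dots> = (\<integral>\<^sup>+y. \<integral>\<^sup>+t. H (y, snd (snd t)) \<partial>\<alpha> \<partial>\<nu>)"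
      by (intro nn_integral_cong \<nu>_integral) measurable
    also have "\<dots> = (\<integral>\<^sup>+x. \<integral>\<^sup>+y. H' (x, y) \<partial>\<alpha> \<partial>\<alpha>)"
      unfolding H'_def fst_conv snd_conv by (rule \<nu>_integral) measurable
    finally have "(\<integral>\<^sup>+w. H w \<partial>(\<nu> \<Otimes>\<^sub>M \<nu>)) = (\<integral>\<^sup>+x. \<integral>\<^sup>+y. H' (x, y) \<partial>\<alpha> \<partial>\<alpha>)" .
    moreover have "(\<integral>\<^sup>+y. L y \<partial>\<nu>) = (\<integral>\<^sup>+t. L (snd (snd t)) \<partial>\<alpha>)"
      by (rule \<nu>_integral) measurable
    moreover have "(\<integral>\<^sup>+z. c z \<partial>distr \<alpha> borel snd) = (\<integral>\<^sup>+t. c (snd t) \<partial>\<alpha>)"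
      by (rule nn_integral_distr) measurable
    ultimately have cost: "total_cost c L H (distr \<alpha> borel snd) = (\<integral>\<^sup>+t. c (snd t) \<partial>\<alpha>)
        + (\<integral>\<^sup>+t. L (snd (snd t)) \<partial>\<alpha>) + (\<integral>\<^sup>+x. \<integral>\<^sup>+y. H' (x, y) \<partial>\<alpha> \<partial>\<alpha>)"
      unfolding total_cost_def \<nu>_def[symmetric] Let_def by simp
    have "4 * d t = ennreal (4 * C\<^sub>0) * ennreal (dist (fst t) (fst (snd t)))" for t
    proof -
      have "4 * d t = ennreal 4 * ennreal (C\<^sub>0 * dist (fst t) (fst (snd t)))"
        by (simp add: d_def)
      also have "\<dots> = ennreal (4 * C\<^sub>0 * dist (fst t) (fst (snd t)))"
        using \<open>0 < C\<^sub>0\<close> by (subst ennreal_mult[symmetric]) (simp_all add: mult.assoc)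
      also have "\<dots> = ennreal (4 * C\<^sub>0) * ennreal (dist (fst t) (fst (snd t)))"
        using \<open>0 < C\<^sub>0\<close> by (intro ennreal_mult) simp_all
      finally show ?thesis .
    qed
    then have "(\<integral>\<^sup>+t. 4 * d t \<partial>\<alpha>)
        = ennreal (4 * C\<^sub>0) * (\<integral>\<^sup>+(x\<^sub>1, x\<^sub>0, y). ennreal (dist x\<^sub>1 x\<^sub>0) \<partial>\<alpha>)"
      by (simp add: case_prod_beta' nn_integral_cmult)
    moreover have "(\<integral>\<^sup>+t. F t \<partial>\<alpha>) = (\<integral>\<^sup>+t. c (snd t) \<partial>\<alpha>)
        + (\<integral>\<^sup>+t. L (snd (snd t)) \<partial>\<alpha>) + (\<integral>\<^sup>+t. 4 * d t \<partial>\<alpha>)"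
      unfolding F_def by (simp add: nn_integral_add)
    ultimately show ?thesis unfolding cost by (simp only: ac_simps)
  qed
  finally have total: "(\<integral>\<^sup>+i. c (Z i) \<partial>W) + (\<integral>\<^sup>+i. L (snd (Z i)) \<partial>W)
      + (\<integral>\<^sup>+i. \<integral>\<^sup>+j. (if i = j then 0 else H (snd (Z i), snd (Z j))) \<partial>W \<partial>W)
     \<le> total_cost c L H (distr \<alpha> borel snd)
      + ennreal (4 * C\<^sub>0) * (\<integral>\<^sup>+(x\<^sub>1, x\<^sub>0, y). ennreal (dist x\<^sub>1 x\<^sub>0) \<partial>\<alpha>)" .
  have "emeasure W {j. fst (Z j) \<in> A} \<le> emeasure (distr \<alpha> borel fst) (\<Union>a\<in>A. ball a \<delta>)" for A
    using close[of A] by (simp add: Z_def)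
  then show thesis
    by (rule that[OF W W_sets total atoms])
qed

text \<open>
  When the right-hand side is finite, approximate gluing costs an extra \<open>e = 4 * C\<^sub>0 * \<epsilon>\<close>, and the
  limit of the discrete competitors is a plan for \<open>\<mu>\<^sub>1\<close> within that bound.
\<close>

lemma optimal_cost_le_transport:
  fixes c :: "'a::polish_space \<times> 'b::polish_space \<Rightarrow> ennreal"
    and L :: "'b \<Rightarrow> ennreal" and H :: "'b \<times> 'b \<Rightarrow> ennreal" and C\<^sub>0 :: real
  assumes c: "lower_semicontinuous c" and L: "lower_semicontinuous L" and H: "lower_semicontinuous H"
    and compact: "\<And>\<kappa>::real. 0 < \<kappa> \<Longrightarrow> compact {y. L y \<le> ennreal \<kappa>}"
    and "0 < C\<^sub>0"
    and G_c: "\<And>x\<^sub>0 x\<^sub>1 y. c (x\<^sub>1, G x\<^sub>1 x\<^sub>0 y) \<le> c (x\<^sub>0, y) + ennreal (C\<^sub>0 * dist x\<^sub>1 x\<^sub>0)"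
    and G_L: "\<And>x\<^sub>0 x\<^sub>1 y. L (G x\<^sub>1 x\<^sub>0 y) \<le> L y + ennreal (C\<^sub>0 * dist x\<^sub>1 x\<^sub>0)"
    and G_H: "\<And>x\<^sub>0 x\<^sub>1 x\<^sub>0' x\<^sub>1' y y'. H (G x\<^sub>1 x\<^sub>0 y, G x\<^sub>1' x\<^sub>0' y')
      \<le> H (y, y') + ennreal (C\<^sub>0 * (dist x\<^sub>1 x\<^sub>0 + dist x\<^sub>1' x\<^sub>0'))"
    and \<mu>\<^sub>1: "\<mu>\<^sub>1 \<in> borel_probs"
    and \<gamma>: "\<gamma> \<in> probs_with_fst_marginal \<mu>\<^sub>0" and \<pi>: "\<pi> \<in> couplings \<mu>\<^sub>0 \<mu>\<^sub>1"
  shows "(INF \<gamma>'\<in>probs_with_fst_marginal \<mu>\<^sub>1. total_cost c L H \<gamma>')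
    \<le> total_cost c L H \<gamma> + ennreal (4 * C\<^sub>0) * (\<integral>\<^sup>+(x\<^sub>0, x\<^sub>1). ennreal (dist x\<^sub>0 x\<^sub>1) \<partial>\<pi>)"
    (is "?inf \<le> ?rhs")
proof (rule ennreal_le_epsilon)
  fix e :: real assume finite: "?rhs < \<top>" and "0 < e"
  define \<epsilon> where "\<epsilon> = e / (4 * C\<^sub>0)"
  have "0 < \<epsilon>" using \<open>0 < e\<close> \<open>0 < C\<^sub>0\<close> by (simp add: \<epsilon>_def)
  obtain \<alpha> :: "('a \<times> 'a \<times> 'b) measure" where \<alpha>: "\<alpha> \<in> borel_probs"
    and \<alpha>_fst: "distr \<alpha> borel fst = \<mu>\<^sub>1" and \<alpha>_snd: "distr \<alpha> borel snd = \<gamma>"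
    and \<alpha>_dist: "(\<integral>\<^sup>+(x\<^sub>1, x\<^sub>0, y). ennreal (dist x\<^sub>1 x\<^sub>0) \<partial>\<alpha>)
      \<le> (\<integral>\<^sup>+(x\<^sub>0, x\<^sub>1). ennreal (dist x\<^sub>0 x\<^sub>1) \<partial>\<pi>) + ennreal \<epsilon>"
    by (rule approximate_gluing[OF \<pi> \<gamma> \<open>0 < \<epsilon>\<close>]) (rule that)
  define K where "K = total_cost c L H \<gamma>
    + ennreal (4 * C\<^sub>0) * (\<integral>\<^sup>+(x\<^sub>1, x\<^sub>0, y). ennreal (dist x\<^sub>1 x\<^sub>0) \<partial>\<alpha>)"
  have "K \<le> total_cost c L H \<gamma>
    + ennreal (4 * C\<^sub>0) * ((\<integral>\<^sup>+(x\<^sub>0, x\<^sub>1). ennreal (dist x\<^sub>0 x\<^sub>1) \<partial>\<pi>) + ennreal \<epsilon>)"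
    unfolding K_def by (intro add_left_mono mult_left_mono \<alpha>_dist) simp
  also have "\<dots> = ?rhs + ennreal (4 * C\<^sub>0) * ennreal \<epsilon>"
    by (simp only: distrib_left add.assoc)
  also have "ennreal (4 * C\<^sub>0) * ennreal \<epsilon> = ennreal e"
    using \<open>0 < C\<^sub>0\<close> \<open>0 < \<epsilon>\<close> by (simp add: \<epsilon>_def flip: ennreal_mult)
  finally have K: "K \<le> ?rhs + ennreal e" .
  also have "\<dots> < \<top>" using finite by simp
  finally have "K < \<top>" .
  define competitor where "competitor n W Z \<longleftrightarrow> prob_space W \<and> sets W = UNIV
    \<and> (\<integral>\<^sup>+i. c (Z i) \<partial>W) + (\<integral>\<^sup>+i. L (snd (Z i)) \<partial>W)
      + (\<integral>\<^sup>+i. \<integral>\<^sup>+j. (if i = j then 0 else H (snd (Z i), snd (Z j))) \<partial>W \<partial>W) \<le> K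
    \<and> (\<forall>j. emeasure W {j} \<le> 1 / of_nat (Suc n))
    \<and> (\<forall>A. emeasure W {j. fst (Z j) \<in> A} \<le> emeasure \<mu>\<^sub>1 (\<Union>a\<in>A. ball a (1 / real (Suc n))))"
    for n and W :: "nat measure" and Z :: "nat \<Rightarrow> 'a \<times> 'b"
  have "\<exists>W Z. competitor n W Z" for n
    by (rule discrete_competitor[OF lower_semicontinuous_borel_measurable[OF c]
          lower_semicontinuous_borel_measurable[OF L] lower_semicontinuous_borel_measurable[OF H]
          \<open>0 < C\<^sub>0\<close> G_c G_L G_H \<alpha>, of "Suc n" "1 / real (Suc n)", unfolded \<alpha>_fst \<alpha>_snd, folded K_def])
      (simp, simp, unfold competitor_def, blast)
  then obtain W Z where "\<And>n. competitor n (W n) (Z n)"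
    by metis
  then have "\<And>n. prob_space (W n)" "\<And>n. sets (W n) = UNIV"
    "\<And>n. (\<integral>\<^sup>+i. c (Z n i) \<partial>W n) + (\<integral>\<^sup>+i. L (snd (Z n i)) \<partial>W n)
      + (\<integral>\<^sup>+i. \<integral>\<^sup>+j. (if i = j then 0 else H (snd (Z n i), snd (Z n j))) \<partial>W n \<partial>W n) \<le> K"
    "\<And>n j. emeasure (W n) {j} \<le> 1 / of_nat (Suc n)"
    "\<And>n A. emeasure (W n) {j. fst (Z n j) \<in> A} \<le> emeasure \<mu>\<^sub>1 (\<Union>a\<in>A. ball a (1 / real (Suc n)))"
    unfolding competitor_def by blast+
  from limit_of_discrete_competitors[OF c L H compact \<mu>\<^sub>1 \<open>K < \<top>\<close> this]
  obtain \<gamma>' where "\<gamma>' \<in> probs_with_fst_marginal \<mu>\<^sub>1" "total_cost c L H \<gamma>' \<le> K"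
    by blast
  then have "?inf \<le> K" by (rule INF_lower2)
  with K show "?inf \<le> ?rhs + ennreal e" by simp
qed

lemma wasserstein1_swap_le:
  fixes \<mu>\<^sub>0 \<mu>\<^sub>1 :: "'a::{metric_space, second_countable_topology} measure"
  shows "wasserstein1 \<mu>\<^sub>1 \<mu>\<^sub>0 \<le> wasserstein1 \<mu>\<^sub>0 \<mu>\<^sub>1"
  unfolding wasserstein1_def
proof (rule INF_mono)
  fix \<pi> assume "\<pi> \<in> couplings \<mu>\<^sub>0 \<mu>\<^sub>1"
  then have \<pi>: "\<pi> \<in> borel_probs" "distr \<pi> borel fst = \<mu>\<^sub>0" "distr \<pi> borel snd = \<mu>\<^sub>1"
    by (auto simp: couplings_def)
  have [measurable_cong]: "sets \<pi> = sets (borel \<Otimes>\<^sub>M borel)"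
    unfolding borel_prod by (rule borel_probs_sets[OF \<pi>(1)])
  have swap [measurable]: "(\<lambda>p. (snd p, fst p)) \<in> borel_measurable \<pi>"
    unfolding borel_prod[symmetric] by measurable
  have [measurable]: "(fst :: 'a \<times> 'a \<Rightarrow> 'a) \<in> borel_measurable borel"
    "(snd :: 'a \<times> 'a \<Rightarrow> 'a) \<in> borel_measurable borel"
    unfolding borel_prod[symmetric] by measurable
  define \<pi>' where "\<pi>' = distr \<pi> borel (\<lambda>p. (snd p, fst p))"
  have "\<pi>' \<in> couplings \<mu>\<^sub>1 \<mu>\<^sub>0"
    unfolding couplings_def \<pi>'_def
    using \<pi> by (auto intro!: borel_probs_distr borel_probs_prob_space simp: distr_distr comp_def)
  moreover have "(\<integral>\<^sup>+(x\<^sub>0, x\<^sub>1). ennreal (dist x\<^sub>0 x\<^sub>1) \<partial>\<pi>') = (\<integral>\<^sup>+(x\<^sub>0, x\<^sub>1). ennreal (dist x\<^sub>0 x\<^sub>1) \<partial>\<pi>)"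
    unfolding \<pi>'_def case_prod_beta' by (subst nn_integral_distr) (auto simp: dist_commute)
  ultimately show "\<exists>\<pi>'\<in>couplings \<mu>\<^sub>1 \<mu>\<^sub>0. (\<integral>\<^sup>+(x\<^sub>0, x\<^sub>1). ennreal (dist x\<^sub>0 x\<^sub>1) \<partial>\<pi>')
      \<le> (\<integral>\<^sup>+(x\<^sub>0, x\<^sub>1). ennreal (dist x\<^sub>0 x\<^sub>1) \<partial>\<pi>)"
    by (intro bexI[of _ \<pi>']) auto
qed

lemma INF_add_cmult_INF_greatest:
  fixes f :: "'i \<Rightarrow> ennreal" and g :: "'j \<Rightarrow> ennreal"
  assumes "0 < C" and le: "\<And>i j. i \<in> A \<Longrightarrow> j \<in> B \<Longrightarrow> b \<le> f i + ennreal C * g j"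
  shows "b \<le> (INF i\<in>A. f i) + ennreal C * (INF j\<in>B. g j)"
proof (rule ennreal_le_epsilon)
  define a w where "a = (INF i\<in>A. f i)" and "w = (INF j\<in>B. g j)"
  fix e :: real assume "(INF i\<in>A. f i) + ennreal C * (INF j\<in>B. g j) < \<top>" and "0 < e"
  then have finite: "a + ennreal C * w < \<top>" by (simp only: a_def w_def)
  have "a \<noteq> \<top>" using finite by auto
  then obtain i where i: "i \<in> A" "f i < a + ennreal (e / 2)"
    using INF_approx_ennreal[of "e / 2" a f A] \<open>0 < e\<close> by (auto simp: a_def)
  have "w \<noteq> \<top>" using finite \<open>0 < C\<close> by (auto simp: ennreal_mult_top)
  then obtain j where j: "j \<in> B" "g j < w + ennreal (e / (2 * C))"
    using INF_approx_ennreal[of "e / (2 * C)" w g B] \<open>0 < e\<close> \<open>0 < C\<close> by (auto simp: w_def)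
  have "b \<le> f i + ennreal C * g j" using i j by (intro le)
  also have "\<dots> \<le> (a + ennreal (e / 2)) + ennreal C * (w + ennreal (e / (2 * C)))"
    using i j by (intro add_mono mult_left_mono) auto
  also have "\<dots> = a + ennreal C * w + (ennreal (e / 2) + ennreal C * ennreal (e / (2 * C)))"
    by (simp only: distrib_left ac_simps)
  also have "ennreal (e / 2) + ennreal C * ennreal (e / (2 * C)) = ennreal e"
    using \<open>0 < e\<close> \<open>0 < C\<close> by (simp flip: ennreal_mult ennreal_plus)
  finally show "b \<le> (INF i\<in>A. f i) + ennreal C * (INF j\<in>B. g j) + ennreal e"
    by (simp only: a_def w_def)
qed

lemma abs_difference_le:
  assumes "0 < C" and ab: "a \<le> b + ennreal C * w" and ba: "b \<le> a + ennreal C * w"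
  shows "abs_difference a b \<le> ereal C * enn2ereal w"
proof (cases "w = \<top>")
  case True
  then show ?thesis using \<open>0 < C\<close> by (simp add: top_ennreal.rep_eq top_ereal_def)
next
  case False
  then obtain w' where w: "w = ennreal w'" "0 \<le> w'" by (cases w) auto
  show ?thesis
  proof (cases "a = \<top> \<or> b = \<top>")
    case True
    then have "a = \<top>" "b = \<top>"
      using ab ba w by (auto simp: top_unique ennreal_mult_eq_top_iff)
    then show ?thesis using w \<open>0 < C\<close> by (simp add: abs_difference_def)
  next
    case False
    then obtain a' b' where "a = ennreal a'" "0 \<le> a'" "b = ennreal b'" "0 \<le> b'"
      by (cases a; cases b) auto
    then show ?thesis
      using ab ba w \<open>0 < C\<close>
      by (simp add: abs_difference_def enn2ereal_ennreal abs_le_iff flip: ennreal_mult ennreal_plus)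
  qed
qed

theorem theorem3p12:
  fixes c :: "'a::polish_space \<times> 'b::polish_space \<Rightarrow> ennreal"
    and L :: "'b \<Rightarrow> ennreal"
    and H :: "'b \<times> 'b \<Rightarrow> ennreal"
  assumes "lower_semicontinuous c"
    and "lower_semicontinuous L"
    and "lower_semicontinuous H"
    and "\<And>y y'. H (y, y') = H (y', y)"
    and "\<And>\<kappa>::real. \<kappa> > 0 \<Longrightarrow> compact {y. L y \<le> ennreal \<kappa>}"
    and "\<exists>G. gluing_operator c L H G"
  shows "\<exists>C::real. C > 0 \<and> (\<forall>\<mu>\<^sub>0\<in>borel_probs. \<forall>\<mu>\<^sub>1\<in>borel_probs.
           abs_difference (INF \<gamma>\<in>probs_with_fst_marginal \<mu>\<^sub>0. total_cost c L H \<gamma>)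
                          (INF \<gamma>\<in>probs_with_fst_marginal \<mu>\<^sub>1. total_cost c L H \<gamma>)
             \<le> ereal C * enn2ereal (wasserstein1 \<mu>\<^sub>0 \<mu>\<^sub>1))"
proof -
  obtain G where gluing: "gluing_operator c L H G"
    using assms(6) by blast
  obtain C\<^sub>0 :: real where "0 < C\<^sub>0" and G: "\<forall>x\<^sub>0 x\<^sub>1 x\<^sub>0' x\<^sub>1' y y'.
        c (x\<^sub>1, G x\<^sub>1 x\<^sub>0 y) \<le> c (x\<^sub>0, y) + ennreal (C\<^sub>0 * dist x\<^sub>1 x\<^sub>0) \<and>
        L (G x\<^sub>1 x\<^sub>0 y) \<le> L y + ennreal (C\<^sub>0 * dist x\<^sub>1 x\<^sub>0) \<and>
        H (G x\<^sub>1 x\<^sub>0 y, G x\<^sub>1' x\<^sub>0' y')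
          \<le> H (y, y') + ennreal (C\<^sub>0 * (dist x\<^sub>1 x\<^sub>0 + dist x\<^sub>1' x\<^sub>0'))"
    using gluing unfolding gluing_operator_def by (elim conjE exE) (rule that)
  have G_c: "c (x\<^sub>1, G x\<^sub>1 x\<^sub>0 y) \<le> c (x\<^sub>0, y) + ennreal (C\<^sub>0 * dist x\<^sub>1 x\<^sub>0)"
    and G_L: "L (G x\<^sub>1 x\<^sub>0 y) \<le> L y + ennreal (C\<^sub>0 * dist x\<^sub>1 x\<^sub>0)"
    and G_H: "H (G x\<^sub>1 x\<^sub>0 y, G x\<^sub>1' x\<^sub>0' y')
      \<le> H (y, y') + ennreal (C\<^sub>0 * (dist x\<^sub>1 x\<^sub>0 + dist x\<^sub>1' x\<^sub>0'))" for x\<^sub>0 x\<^sub>1 x\<^sub>0' x\<^sub>1' y y'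
    by (simp_all only: G)
  let ?inf = "\<lambda>\<mu>. INF \<gamma>\<in>probs_with_fst_marginal \<mu>. total_cost c L H \<gamma>"
  have le: "?inf \<mu>\<^sub>1 \<le> ?inf \<mu>\<^sub>0 + ennreal (4 * C\<^sub>0) * wasserstein1 \<mu>\<^sub>0 \<mu>\<^sub>1"
    if "\<mu>\<^sub>1 \<in> borel_probs" for \<mu>\<^sub>0 \<mu>\<^sub>1
    unfolding wasserstein1_def
    using optimal_cost_le_transport[OF assms(1,2,3,5) \<open>0 < C\<^sub>0\<close> G_c G_L G_H that] \<open>0 < C\<^sub>0\<close>
    by (intro INF_add_cmult_INF_greatest) simp_all
  have "abs_difference (?inf \<mu>\<^sub>0) (?inf \<mu>\<^sub>1) \<le> ereal (4 * C\<^sub>0) * enn2ereal (wasserstein1 \<mu>\<^sub>0 \<mu>\<^sub>1)"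
    if "\<mu>\<^sub>0 \<in> borel_probs" "\<mu>\<^sub>1 \<in> borel_probs" for \<mu>\<^sub>0 \<mu>\<^sub>1
  proof (rule abs_difference_le)
    show "?inf \<mu>\<^sub>0 \<le> ?inf \<mu>\<^sub>1 + ennreal (4 * C\<^sub>0) * wasserstein1 \<mu>\<^sub>0 \<mu>\<^sub>1"
      by (rule order.trans[OF le[OF that(1), of \<mu>\<^sub>1]])
        (intro add_left_mono mult_left_mono wasserstein1_swap_le zero_le)
    show "?inf \<mu>\<^sub>1 \<le> ?inf \<mu>\<^sub>0 + ennreal (4 * C\<^sub>0) * wasserstein1 \<mu>\<^sub>0 \<mu>\<^sub>1"
      by (rule le[OF that(2)])
  qed (use \<open>0 < C\<^sub>0\<close> in simp)
  then show ?thesis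
    using \<open>0 < C\<^sub>0\<close> by (intro exI[of _ "4 * C\<^sub>0"]) simp
qed

end
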